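(* There is a constant $c_n$ depending only on the dimension $n$ such that, for every weight $u\in A_1$ on $\mathbb{R}^n$ and every $f\in L^1(u^2)$, $$\Big\|\frac{M(fu)}{u}\Big\|_{L^{1,\infty}(u^2)}\le c_n\,[u]_{A_1}^2\,\|f\|_{L^1(u^2)}.$$
   Context: A weight is a non-negative locally integrable function on $\mathbb{R}^n$, positive a.e. $Mf(x)=\sup_{Q\ni x}\frac1{|Q|}\int_Q|f|$ is the Hardy--Littlewood maximal operator, the supremum over cubes $Q$ with sides parallel to the axes. $u\in A_1$ means $[u]_{A_1}=\operatorname{ess\,sup}_x Mu(x)/u(x)<\infty$. The function $u^2$ need not be locally integrable; $u^2$ also denotes the measure $u(x)^2\,dx$, $\|f\|_{L^1(u^2)}=\int_{\mathbb{R}^n}|f|u^2\,dx$ and $\|h\|_{L^{1,\infty}(u^2)}=\sup_{t>0}t\,u^2(\{x:|h(x)|>t\})$. *)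

theory Defs
  imports "HOL-Analysis.Analysis" "HOL-Probability.Essential_Supremum"
begin

(* Lebesgue measurability of u is implied by local integrability. *)
definition weight :: "(real^'n \<Rightarrow> real) \<Rightarrow> bool" where
  "weight u \<longleftrightarrow>
     (\<forall>x. 0 \<le> u x) \<and>
     (\<forall>K. compact K \<longrightarrow> u absolutely_integrable_on K) \<and>
     (AE x in lebesgue. 0 < u x)"

(* Closed, non-degenerate cubes. The supremum defining the maximal operator is the same
   over open cubes. *)
definition cubes :: "(real^'n) set set" where
  "cubes = {cbox a (\<chi> i. a $ i + l) | a l. 0 < l}"

definition HL_maximal :: "(real^'n \<Rightarrow> real) \<Rightarrow> real^'n \<Rightarrow> ennreal" where
  "HL_maximal f x =
     (SUP Q \<in> {Q \<in> cubes. x \<in> Q}.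
        (\<integral>\<^sup>+ y \<in> Q. ennreal \<bar>f y\<bar> \<partial>lebesgue) / emeasure lebesgue Q)"

(* Where u x = 0, a null set, the quotient follows the ennreal conventions. For a weight u it is
   Lebesgue measurable (the maximal function is lower semicontinuous), so the value that
   esssup takes on non-measurable functions never occurs. *)
definition A1_const :: "(real^'n \<Rightarrow> real) \<Rightarrow> ennreal" where
  "A1_const u = esssup lebesgue (\<lambda>x. HL_maximal u x / ennreal (u x))"

definition A1_weight :: "(real^'n \<Rightarrow> real) \<Rightarrow> bool" where
  "A1_weight u \<longleftrightarrow> weight u \<and> A1_const u < \<infinity>"

definition sq_measure :: "(real^'n \<Rightarrow> real) \<Rightarrow> (real^'n) measure" where
  "sq_measure u = density lebesgue (\<lambda>x. ennreal ((u x)\<^sup>2))"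

definition L1_norm :: "'a measure \<Rightarrow> ('a \<Rightarrow> real) \<Rightarrow> ennreal" where
  "L1_norm \<mu> f = (\<integral>\<^sup>+ x. ennreal \<bar>f x\<bar> \<partial>\<mu>)"

(* Stated for functions with values in [0,\<infinity>], so no absolute value is needed. *)
definition weak_L1_norm :: "'a measure \<Rightarrow> ('a \<Rightarrow> ennreal) \<Rightarrow> ennreal" where
  "weak_L1_norm \<mu> h =
     (SUP t \<in> {0<..}. ennreal t * emeasure \<mu> {x \<in> space \<mu>. h x > ennreal t})"

end

theory Submission
  imports Defs
begin

text \<open>
  Write \<open>A = [u]\<close> for the \<open>A\<^sub>1\<close> constant and \<open>g = \<bar>f\<bar> u\<close>. Splitting the level set of \<open>M g > t u\<close> into the pieces
  \<open>F\<^sub>k\<close> where \<open>u\<close> is comparable to \<open>2^k\<close>, a Vitali covering of \<open>F\<^sub>k\<close> gives \<open>t 2^k |F\<^sub>k| \<le> c \<integral> g q\<^sub>k\<close>, where \<open>q\<^sub>k(y)\<close>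
  is \<open>0\<close> or the proportion of \<open>F\<^sub>k\<close> in some cube containing \<open>y\<close>. Summing over \<open>k\<close> reduces the theorem to the
  pointwise bound \<open>\<Sum> 2^k q\<^sub>k(y) \<le> c A\<^sup>2 u(y)\<close>. Cubes containing \<open>y\<close> have \<open>u\<close>-average at most \<open>s = A u(y)\<close>, so
  the \<open>k\<close> with \<open>2^k \<le> s\<close> contribute at most \<open>2 s\<close>; for the others a quantitative reverse Hoelder effect,
  \<open>|{x \<in> Q. u x > 2^j s}| \<le> 2 |Q| (2 \<rho>)^(-j)\<close> with \<open>\<rho> = 1 + c / A\<close>, gives a geometric series of sum at most
  \<open>c A s\<close>. This decay comes from a Calderon-Zygmund decomposition: the stopped cubes cover almost all of
  \<open>{u > s}\<close>, have \<open>u\<close>-average at most \<open>2^n s\<close>, and lie in \<open>{A u \<ge> s}\<close> by the \<open>A\<^sub>1\<close> condition.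
\<close>

section \<open>Half-open cubes and their dyadic cells\<close>

text \<open>Half-open, because translates of such cubes tile space without overlap, as a dyadic grid
  requires; the measure agrees with that of the closed and the open cube with the same
  corners.\<close>

definition hcube :: "real^'n \<Rightarrow> real \<Rightarrow> (real^'n) set" where
  "hcube a l = {y. \<forall>i. a $ i \<le> y $ i \<and> y $ i < a $ i + l}"

lemma hcube_subset_cbox: "hcube a l \<subseteq> cbox a (\<chi> i. a $ i + l)"
  by (auto simp: hcube_def mem_box_cart less_imp_le)

lemma box_subset_hcube: "box a (\<chi> i. a $ i + l) \<subseteq> hcube a l"
  by (auto simp: hcube_def mem_box_cart less_imp_le)

lemma borel_hcube [measurable]: "hcube a l \<in> sets borel"
proof -
  have "hcube a l = {a..} \<inter> (\<Inter>i. {y. y $ i < a $ i + l})"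
    by (auto simp: hcube_def less_eq_vec_def)
  moreover have "closed {a..}"
    by (simp add: closed_interval_right_cart less_eq_vec_def atLeast_def interval_cbox_cart)
  moreover have "open {y. y $ i < a $ i + l}" for i
    by (rule open_Collect_less) (auto intro!: continuous_intros)
  ultimately show ?thesis by auto
qed

lemma lebesgue_hcube [measurable]: "hcube a l \<in> sets lebesgue"
  using borel_hcube by simp

lemma emeasure_cube_cbox:
  assumes "0 < l"
  shows "emeasure lebesgue (cbox (a :: real^'n) (\<chi> i. a $ i + l)) = ennreal (l ^ CARD('n))"
    and "emeasure lebesgue (box (a :: real^'n) (\<chi> i. a $ i + l)) = ennreal (l ^ CARD('n))"
proof -
  have *: "prod (\<lambda>b. ((\<chi> i. a $ i + l) - a) \<bullet> b) Basis = l ^ CARD('n)"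
    using assms by (auto simp: Basis_vec_def inner_axis axis_eq_axis  prod.UNION_disjoint)
  have **: "\<forall>b\<in>Basis. a \<bullet> b \<le> (\<chi> i. a $ i + l) \<bullet> b"
    using assms by (auto simp: Basis_vec_def inner_axis)
  show "emeasure lebesgue (cbox a (\<chi> i. a $ i + l)) = ennreal (l ^ CARD('n))"
    using * ** by (auto simp: emeasure_lborel_cbox_eq)
  show "emeasure lebesgue (box a (\<chi> i. a $ i + l)) = ennreal (l ^ CARD('n))"
    using * ** by (auto simp: emeasure_lborel_box_eq)
qed

lemma emeasure_hcube:
  assumes "0 < l"
  shows "emeasure lebesgue (hcube (a :: real^'n) l) = ennreal (l ^ CARD('n))"
proof (rule antisym)
  show "emeasure lebesgue (hcube a l) \<le> ennreal (l ^ CARD('n))"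
    using emeasure_mono[OF hcube_subset_cbox, of a l lebesgue] emeasure_cube_cbox(1)[OF assms, of a] by simp
  show "ennreal (l ^ CARD('n)) \<le> emeasure lebesgue (hcube a l)"
    using emeasure_mono[OF box_subset_hcube, of a l lebesgue] emeasure_cube_cbox(2)[OF assms, of a] by simp
qed

text \<open>The cube containing \<open>x\<close> in the dyadic grid of mesh \<open>l / 2^m\<close>
  with origin \<open>a\<close>. Indexing cells by points instead of lattice vectors turns "lying in
  the same cell" into an equality of floors.\<close>

definition cell :: "real^'n \<Rightarrow> real \<Rightarrow> nat \<Rightarrow> real^'n \<Rightarrow> (real^'n) set" where
  "cell a l m x = hcube (\<chi> i. a $ i + l / 2^m * of_int \<lfloor>(x $ i - a $ i) / l * 2^m\<rfloor>) (l / 2^m)"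

lemma mem_cell_iff:
  assumes "0 < l"
  shows "y \<in> cell a l m x \<longleftrightarrow> (\<forall>i. \<lfloor>(y $ i - a $ i) / l * 2^m\<rfloor> = \<lfloor>(x $ i - a $ i) / l * 2^m\<rfloor>)"
proof -
  have "(b + l / 2^m * real_of_int z \<le> c \<and> c < b + l / 2^m * real_of_int z + l / 2^m)
      \<longleftrightarrow> \<lfloor>(c - b) / l * 2^m\<rfloor> = z" for b c z
    using assms by (simp add: floor_eq_iff field_simps)
  then show ?thesis by (simp add: cell_def hcube_def)
qed

lemma cell_self: "0 < l \<Longrightarrow> x \<in> cell a l m x"
  by (simp add: mem_cell_iff)

lemma cell_eq: "0 < l \<Longrightarrow> y \<in> cell a l m x \<Longrightarrow> cell a l m y = cell a l m x"
  by (auto simp: mem_cell_iff)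

lemma cell_Suc_subset:
  assumes "0 < l"
  shows "cell a l (Suc m) x \<subseteq> cell a l m x"
proof
  \<comment> \<open>The grid index at level \<open>m\<close> is recovered from the index at level
    \<open>Suc m\<close> by halving, so the finer grid refines the coarser one.\<close>
  have *: "\<lfloor>r\<rfloor> = \<lfloor>r * 2\<rfloor> div 2" for r :: real
    using floor_divide_real_eq_div[of 2 "r * 2"] by simp
  fix y assume "y \<in> cell a l (Suc m) x"
  then have eq: "\<lfloor>(y $ i - a $ i) / l * 2^m * 2\<rfloor> = \<lfloor>(x $ i - a $ i) / l * 2^m * 2\<rfloor>" for i
    using assms by (simp add: mem_cell_iff mult.assoc mult.commute[of 2])
  have "\<lfloor>(y $ i - a $ i) / l * 2^m\<rfloor> = \<lfloor>(x $ i - a $ i) / l * 2^m\<rfloor>" for i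
    unfolding *[of "(y $ i - a $ i) / l * 2^m"] *[of "(x $ i - a $ i) / l * 2^m"] eq ..
  then show "y \<in> cell a l m x" using assms by (simp add: mem_cell_iff)
qed

lemma cell_antimono: "0 < l \<Longrightarrow> m \<le> k \<Longrightarrow> cell a l k x \<subseteq> cell a l m x"
  by (rule lift_Suc_antimono_le[where f="\<lambda>m. cell a l m x"]) (auto dest: cell_Suc_subset)

lemma cell_0:
  assumes "0 < l" "x \<in> hcube a l"
  shows "cell a l 0 x = hcube a l"
proof -
  have "\<lfloor>(x $ i - a $ i) / l\<rfloor> = 0" for i
    using assms by (simp add: floor_eq_iff hcube_def field_simps)
  then show ?thesis by (simp add: cell_def)
qed

lemma cell_measurable [measurable]: "cell a l m x \<in> sets lebesgue"
  unfolding cell_def by (rule lebesgue_hcube)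

lemma emeasure_cell:
  "0 < l \<Longrightarrow> emeasure lebesgue (cell (a :: real^'n) l m x) = ennreal ((l / 2^m) ^ CARD('n))"
  unfolding cell_def by (rule emeasure_hcube) simp

lemma countable_cells: "countable (range (\<lambda>(m, x). cell (a :: real^'n) l m x))"
proof -
  have "range (\<lambda>(m, x). cell a l m x) \<subseteq>
    range (\<lambda>(m, z :: int^'n). hcube (\<chi> i. a $ i + l / 2^m * of_int (z $ i)) (l / 2^m))"
  proof
    fix C assume "C \<in> range (\<lambda>(m, x). cell a l m x)"
    then obtain m x where "C = cell a l m x" by auto
    then show "C \<in> range (\<lambda>(m, z :: int^'n). hcube (\<chi> i. a $ i + l / 2^m * of_int (z $ i)) (l / 2^m))"
      unfolding cell_def
      by (intro image_eqI[where x="(m, \<chi> i. \<lfloor>(x $ i - a $ i) / l * 2^m\<rfloor>)"]) auto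
  qed
  then show ?thesis by (rule countable_subset) auto
qed

text \<open>The cells of minimal level with property \<open>P\<close> are pairwise disjoint.\<close>

lemma stopped_cells:
  fixes a :: "real^'n"
  assumes "0 < l" and sets [measurable_cong]: "sets \<nu> = sets lebesgue"
    and le: "\<And>m x. P (cell a l m x) \<Longrightarrow> (\<And>j. j < m \<Longrightarrow> \<not> P (cell a l j x)) \<Longrightarrow>
      emeasure \<nu> (cell a l m x) \<le> \<kappa> * emeasure lebesgue (cell a l m x)"
  defines "W \<equiv> {x. \<exists>m. P (cell a l m x)}"
  shows "W \<in> sets lebesgue" and "emeasure \<nu> W \<le> \<kappa> * emeasure lebesgue W"
proof -
  define N where "N x = (LEAST m. P (cell a l m x))" for x
  define \<C> where "\<C> = (\<lambda>x. cell a l (N x) x) ` W"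
  have PN: "P (cell a l (N x) x)" if "x \<in> W" for x
    using that unfolding W_def N_def by (auto intro: LeastI)
  have minN: "\<not> P (cell a l j x)" if "j < N x" for x j
    using that unfolding N_def by (rule not_less_Least)
  \<comment> \<open>Up to level \<open>N x\<close> the points \<open>x\<close> and \<open>y\<close>
    have the same cells, so the search for the first cell with \<open>P\<close> stops at the same
    level for both.\<close>
  have same: "cell a l (N y) y = cell a l (N x) x \<and> y \<in> W" if "x \<in> W" "y \<in> cell a l (N x) x" for x y
  proof -
    have eq: "cell a l m y = cell a l m x" if "m \<le> N x" for m
      using cell_antimono[OF \<open>0 < l\<close> that] \<open>y \<in> _\<close> cell_eq[OF \<open>0 < l\<close>] by blast
    have "N y = N x"
      unfolding N_def[of y]
    proof (rule Least_equality)
      show "P (cell a l (N x) y)" using PN[OF \<open>x \<in> W\<close>] eq by simp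
      show "N x \<le> m" if "P (cell a l m y)" for m
        using that eq[of m] minN[of m x] by (cases "m < N x") auto
    qed
    moreover have "y \<in> W" using eq[of "N x"] PN[OF \<open>x \<in> W\<close>] unfolding W_def by (auto intro!: exI[of _ "N x"])
    ultimately show ?thesis using eq by simp
  qed
  have "\<C> \<subseteq> range (\<lambda>(m, x). cell a l m x)" unfolding \<C>_def by auto
  then have count: "countable \<C>" by (rule countable_subset[OF _ countable_cells])
  have meas: "C \<in> sets lebesgue" if "C \<in> \<C>" for C
    using that unfolding \<C>_def by auto
  have W: "W = \<Union>\<C>"
  proof
    show "W \<subseteq> \<Union>\<C>" using cell_self[OF \<open>0 < l\<close>] unfolding \<C>_def by blast
    show "\<Union>\<C> \<subseteq> W" using same unfolding \<C>_def by blast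
  qed
  have "C = D" if "C \<in> \<C>" "D \<in> \<C>" "z \<in> C" "z \<in> D" for C D z
  proof -
    obtain x y where "x \<in> W" "C = cell a l (N x) x" "y \<in> W" "D = cell a l (N y) y"
      using \<open>C \<in> \<C>\<close> \<open>D \<in> \<C>\<close> unfolding \<C>_def by blast
    then show ?thesis using same[of x z] same[of y z] \<open>z \<in> C\<close> \<open>z \<in> D\<close> by simp
  qed
  then have disj: "disjoint_family_on (\<lambda>C. C) \<C>"
    unfolding disjoint_family_on_def by blast
  show "W \<in> sets lebesgue"
    unfolding W using count meas by (intro sets.countable_Union) auto
  \<comment> \<open>Kept general in \<open>M\<close>, since it serves both for \<open>\<nu>\<close>
    and for Lebesgue measure.\<close>
  have add: "emeasure M W = (\<integral>\<^sup>+ C. emeasure M C \<partial>count_space \<C>)" if "sets M = sets lebesgue" for M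
    using emeasure_UN_countable[OF _ count disj, of M] meas that W by simp
  have "emeasure \<nu> W \<le> (\<integral>\<^sup>+ C. \<kappa> * emeasure lebesgue C \<partial>count_space \<C>)"
    unfolding add[OF sets]
  proof (rule nn_integral_mono)
    fix C assume "C \<in> space (count_space \<C>)"
    then obtain x where "x \<in> W" "C = cell a l (N x) x" unfolding \<C>_def by auto
    then show "emeasure \<nu> C \<le> \<kappa> * emeasure lebesgue C"
      using le[OF PN minN] by blast
  qed
  also have "\<dots> = \<kappa> * emeasure lebesgue W"
    by (simp add: nn_integral_cmult add)
  finally show "emeasure \<nu> W \<le> \<kappa> * emeasure lebesgue W" .
qed

section \<open>Differentiation along dyadic cells\<close>

lemma cell_subset_open:
  fixes a :: "real^'n"
  assumes "0 < l" "open O'" "x \<in> O'"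
  obtains m where "cell a l m x \<subseteq> O'"
proof -
  obtain r where r: "0 < r" "ball x r \<subseteq> O'" using assms open_contains_ball by blast
  obtain m where m: "real CARD('n) * l / r < 2 ^ m"
    using real_arch_pow[of 2] by auto
  have "cell a l m x \<subseteq> ball x r"
  proof
    fix y assume y: "y \<in> cell a l m x"
    have *: "\<bar>x' - y'\<bar> \<le> d" if "b \<le> x'" "x' < b + d" "b \<le> y'" "y' < b + d" for x' y' b d :: real
      using that by linarith
    have "\<bar>(x - y) $ i\<bar> \<le> l / 2^m" for i
      using y cell_self[OF \<open>0 < l\<close>, of x a m]
      unfolding cell_def hcube_def vector_minus_component mem_Collect_eq by (blast intro: *)
    then have "norm (x - y) \<le> (\<Sum>i\<in>(UNIV::'n set). l / 2^m)"
      by (intro order_trans[OF norm_le_l1_cart] sum_mono) auto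
    also have "\<dots> < r" using m r by (simp add: field_simps)
    finally show "y \<in> ball x r" by (simp add: dist_norm)
  qed
  then show thesis using that r by blast
qed

text \<open>One half of the Lebesgue differentiation theorem along the grid, by a covering argument.
  The set \<open>T\<close> where \<open>u\<close> exceeds \<open>s\<close> by \<open>e\<close> is
  enclosed in an open \<open>G\<close> of nearly the same measure. The first cells that lie in
  \<open>G\<close> and have average at most \<open>s\<close> cover \<open>T\<close>, so (s + e) |T|
  \<le> s |G|, and letting |G| tend to |T| forces |T| = 0.\<close>

lemma AE_le_of_cell_averages:
  fixes u :: "real^'n \<Rightarrow> real"
  assumes u [measurable]: "u \<in> borel_measurable lebesgue" and "0 < l" "0 \<le> s"
    and S [measurable]: "S \<in> sets lebesgue" and fin: "emeasure lebesgue S < \<infinity>"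
    and avg: "\<And>x m. x \<in> S \<Longrightarrow>
      emeasure (density lebesgue u) (cell a l m x) \<le> ennreal s * emeasure lebesgue (cell a l m x)"
  shows "AE x in lebesgue. x \<in> S \<longrightarrow> u x \<le> s"
proof -
  let ?\<nu> = "density lebesgue u"
  have null: "emeasure lebesgue {x \<in> S. s + e \<le> u x} = 0" if "0 < e" for e :: real
  proof -
    define T where "T = {x \<in> S. s + e \<le> u x}"
    have T [measurable]: "T \<in> sets lebesgue" unfolding T_def by measurable
    have TS: "emeasure lebesgue T \<le> emeasure lebesgue S" unfolding T_def by (intro emeasure_mono) auto
    then obtain t where t: "emeasure lebesgue T = ennreal t" "0 \<le> t"
      using fin by (cases "emeasure lebesgue T") (auto simp: top_unique)
    have key: "e * t \<le> s * \<delta>" if "0 < \<delta>" for \<delta>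
    proof -
      obtain G where G: "open G" "T \<subseteq> G" "G - T \<in> lmeasurable" "emeasure lebesgue (G - T) < ennreal \<delta>"
        using sets_lebesgue_outer_open[OF T \<open>0 < \<delta>\<close>] by blast
      have [measurable]: "G \<in> sets lebesgue" using G(1) by auto
      define P where "P C \<longleftrightarrow> C \<subseteq> G \<and> emeasure ?\<nu> C \<le> ennreal s * emeasure lebesgue C" for C
      define W where "W = {x. \<exists>m. P (cell a l m x)}"
      have W: "W \<in> sets lebesgue" "emeasure ?\<nu> W \<le> ennreal s * emeasure lebesgue W"
        unfolding W_def by (rule stopped_cells[OF \<open>0 < l\<close>, where \<nu> = ?\<nu> and \<kappa> = "ennreal s"]; simp add: P_def)+
      have "W \<subseteq> G" using cell_self[OF \<open>0 < l\<close>] unfolding W_def P_def by blast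
      have "T \<subseteq> W"
      proof
        fix x assume "x \<in> T"
        then obtain m where "cell a l m x \<subseteq> G" using cell_subset_open[OF \<open>0 < l\<close> G(1), of x] G(2) by blast
        then show "x \<in> W" using avg[of x m] \<open>x \<in> T\<close> unfolding W_def P_def T_def by blast
      qed
      have "ennreal ((s + e) * t) = (\<integral>\<^sup>+x. ennreal (s + e) * indicator T x \<partial>lebesgue)"
        using t \<open>0 < e\<close> \<open>0 \<le> s\<close> by (subst nn_integral_cmult_indicator) (auto simp: ennreal_mult)
      also have "\<dots> \<le> emeasure ?\<nu> T"
        by (subst emeasure_density) (auto intro!: nn_integral_mono split: split_indicator simp: T_def ennreal_leI)
      also have "\<dots> \<le> emeasure ?\<nu> W" using \<open>T \<subseteq> W\<close> W(1) by (intro emeasure_mono) auto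
      also have "\<dots> \<le> ennreal s * emeasure lebesgue G"
        by (rule order_trans[OF W(2) mult_left_mono[OF emeasure_mono[OF \<open>W \<subseteq> G\<close>]]]) auto
      also have "\<dots> \<le> ennreal (s * (t + \<delta>))"
      proof -
        have "emeasure lebesgue G = emeasure lebesgue T + emeasure lebesgue (G - T)"
          using G(2) by (subst plus_emeasure) (auto simp: Un_absorb1)
        also have "\<dots> \<le> ennreal t + ennreal \<delta>" using G(4) t by (intro add_mono) auto
        also have "\<dots> = ennreal (t + \<delta>)" using t \<open>0 < \<delta>\<close> by simp
        finally show ?thesis using \<open>0 \<le> s\<close> t(2) \<open>0 < \<delta>\<close> by (simp add: ennreal_mult mult_left_mono del: emeasure_completion)
      qed
      finally have "(s + e) * t \<le> s * (t + \<delta>)"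
        using t(2) \<open>0 < \<delta>\<close> \<open>0 \<le> s\<close> by (simp add: ennreal_le_iff)
      then show ?thesis by (simp add: algebra_simps)
    qed
    \<comment> \<open>Dividing by \<open>s + 1\<close> rather than by \<open>s\<close> also covers
      \<open>s = 0\<close>.\<close>
    have "e * t \<le> s * (\<delta> / (s + 1))" if "0 < \<delta>" for \<delta>
      using that \<open>0 \<le> s\<close> by (intro key) simp
    moreover have "s * (\<delta> / (s + 1)) \<le> \<delta>" if "0 < \<delta>" for \<delta>
      using that \<open>0 \<le> s\<close> by (simp add: field_simps)
    ultimately have "e * t \<le> \<delta>" if "0 < \<delta>" for \<delta>
      using that order_trans by blast
    then have "e * t \<le> 0" by (rule field_le_epsilon) simp
    then have "t = 0" using t \<open>0 < e\<close> by (simp add: mult_le_0_iff)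
    then show ?thesis using t unfolding T_def by simp
  qed
  have "AE x in lebesgue. \<forall>n::nat. \<not> (x \<in> S \<and> s + inverse (Suc n) \<le> u x)"
    unfolding AE_all_countable
  proof
    fix n :: nat
    show "AE x in lebesgue. \<not> (x \<in> S \<and> s + inverse (Suc n) \<le> u x)"
      using null[of "inverse (Suc n)"] by (subst AE_iff_measurable[OF _ refl]) auto
  qed
  then show ?thesis
  proof eventually_elim
    case (elim x)
    show ?case
    proof (intro impI leI notI)
      assume "x \<in> S" "s < u x"
      then obtain n where "inverse (real (Suc n)) < u x - s" using reals_Archimedean[of "u x - s"] by auto
      then show False using elim \<open>x \<in> S\<close> by (auto simp: not_le dest: spec[of _ n])
    qed
  qed
qed

section \<open>The Calderon-Zygmund step\<close>

text \<open>The A1 condition in the form used below: one null set serves all cubes, and the quotient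
  by \<open>u\<close> is multiplied out. \<open>A\<close> stands for the A1 constant.\<close>

locale A1_bound =
  fixes u :: "real^'n \<Rightarrow> real" and A :: real
  assumes u_nonneg: "0 \<le> u x"
    and u_measurable [measurable]: "u \<in> borel_measurable lebesgue"
    and A_ge_1: "1 \<le> A"
    and finite_hcube: "emeasure (density lebesgue u) (hcube a l) < \<infinity>"
    and average_le: "AE x in lebesgue. \<forall>a l. 0 < l \<longrightarrow> x \<in> hcube a l \<longrightarrow>
      emeasure (density lebesgue u) (hcube a l) \<le> ennreal (A * u x * l ^ CARD('n))"
begin

abbreviation "\<nu> \<equiv> density lebesgue (\<lambda>x. ennreal (u x))"

text \<open>The stopped cells are the maximal ones with average above \<open>s\<close>. The parent
  of a stopped cell has average at most \<open>s\<close>, whence the factor 2^n; the A1 condition on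
  a stopped cell gives \<open>s \<le> A * u\<close> almost everywhere there; outside the stopped
  cells differentiation gives \<open>u \<le> s\<close>.\<close>

lemma reverse_weak_type:
  assumes "0 < l" "0 < s" and Q: "emeasure \<nu> (hcube a l) \<le> ennreal (s * l ^ CARD('n))"
  shows "emeasure \<nu> {x \<in> hcube a l. s < u x} \<le>
    ennreal (2 ^ CARD('n) * s) * emeasure lebesgue {x \<in> hcube a l. s \<le> A * u x}"
proof -
  define P where "P C \<longleftrightarrow> C \<subseteq> hcube a l \<and> \<not> emeasure \<nu> C \<le> ennreal s * emeasure lebesgue C" for C
  define W where "W = {x. \<exists>m. P (cell a l m x)}"
  have step: "emeasure \<nu> (cell a l m x) \<le> ennreal (2 ^ CARD('n) * s) * emeasure lebesgue (cell a l m x)"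
    if P: "P (cell a l m x)" and min: "\<And>j. j < m \<Longrightarrow> \<not> P (cell a l j x)" for m x
  proof -
    have x: "x \<in> hcube a l" using P cell_self[OF \<open>0 < l\<close>] unfolding P_def by blast
    \<comment> \<open>The whole cube is not stopped, by assumption \<open>Q\<close>, so every
      stopped cell has a parent inside it.\<close>
    have "m \<noteq> 0"
    proof
      assume "m = 0"
      then show False using P x Q \<open>0 < l\<close> \<open>0 < s\<close>
        unfolding P_def by (simp add: cell_0 emeasure_hcube ennreal_mult del: emeasure_completion)
    qed
    then obtain j where m: "m = Suc j" by (cases m) auto
    have "cell a l j x \<subseteq> hcube a l"
      using cell_antimono[OF \<open>0 < l\<close>, of 0 j a x] x by (simp add: cell_0 \<open>0 < l\<close>)
    then have "emeasure \<nu> (cell a l j x) \<le> ennreal s * emeasure lebesgue (cell a l j x)"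
      using min[of j] m unfolding P_def by auto
    also have "\<dots> = ennreal (2 ^ CARD('n) * s) * emeasure lebesgue (cell a l m x)"
      using \<open>0 < l\<close> \<open>0 < s\<close> by (simp add: m emeasure_cell ennreal_mult[symmetric] power_divide power_mult_distrib field_simps del: emeasure_completion)
    finally show ?thesis
      using emeasure_mono[OF cell_antimono[OF \<open>0 < l\<close>, of j m a x], of \<nu>] m by (auto intro: order_trans)
  qed
  have W: "W \<in> sets lebesgue" "emeasure \<nu> W \<le> ennreal (2 ^ CARD('n) * s) * emeasure lebesgue W"
    unfolding W_def by (rule stopped_cells[OF \<open>0 < l\<close> _ step]; simp)+
  have [measurable]: "W \<in> sets lebesgue" by (rule W)
  have "W \<subseteq> hcube a l" using cell_self[OF \<open>0 < l\<close>] unfolding W_def P_def by blast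
  have "AE x in lebesgue. x \<in> W \<longrightarrow> s \<le> A * u x"
    using average_le
  proof eventually_elim
    case (elim x)
    show ?case
    proof
      assume "x \<in> W"
      then obtain m where m: "\<not> emeasure \<nu> (cell a l m x) \<le> ennreal s * emeasure lebesgue (cell a l m x)"
        unfolding W_def P_def by auto
      have "emeasure \<nu> (cell a l m x) \<le> ennreal (A * u x * (l / 2^m) ^ CARD('n))"
        using elim cell_self[OF \<open>0 < l\<close>, of x a m] \<open>0 < l\<close> unfolding cell_def by simp
      then have "\<not> ennreal (A * u x * (l / 2^m) ^ CARD('n)) \<le> ennreal (s * (l / 2^m) ^ CARD('n))"
        using m \<open>0 < l\<close> \<open>0 < s\<close> by (auto simp: emeasure_cell ennreal_mult simp del: emeasure_completion)
      then have "\<not> A * u x * (l / 2^m) ^ CARD('n) \<le> s * (l / 2^m) ^ CARD('n)"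
        by (auto dest: ennreal_leI)
      then have "\<not> A * u x \<le> s"
        using \<open>0 < l\<close> by (auto simp: mult_right_mono)
      then show "s \<le> A * u x" by simp
    qed
  qed
  then have "emeasure lebesgue W \<le> emeasure lebesgue {x \<in> hcube a l. s \<le> A * u x}"
    using \<open>W \<subseteq> hcube a l\<close> by (intro emeasure_mono_AE) auto
  then have 1: "emeasure \<nu> W \<le> ennreal (2 ^ CARD('n) * s) * emeasure lebesgue {x \<in> hcube a l. s \<le> A * u x}"
    by (elim order_trans[OF W(2) mult_left_mono]) simp
  have "AE x in lebesgue. x \<in> hcube a l - W \<longrightarrow> u x \<le> s"
  proof (rule AE_le_of_cell_averages[OF u_measurable \<open>0 < l\<close>])
    show "emeasure lebesgue (hcube a l - W) < \<infinity>"
      using emeasure_mono[of "hcube a l - W" "hcube a l" lebesgue] emeasure_hcube[OF \<open>0 < l\<close>, of a]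
      by (auto simp: less_top[symmetric] top_unique simp del: emeasure_completion)
    fix x m assume x: "x \<in> hcube a l - W"
    then have "cell a l m x \<subseteq> hcube a l"
      using cell_antimono[OF \<open>0 < l\<close>, of 0 m a x] by (simp add: cell_0 \<open>0 < l\<close>)
    then show "emeasure \<nu> (cell a l m x) \<le> ennreal s * emeasure lebesgue (cell a l m x)"
      using x unfolding W_def P_def by auto
  qed (use \<open>0 < s\<close> in auto)
  then have "AE x in \<nu>. x \<in> {x \<in> hcube a l. s < u x} \<longrightarrow> x \<in> W"
    by (subst AE_density) auto
  then have "emeasure \<nu> {x \<in> hcube a l. s < u x} \<le> emeasure \<nu> W"
    by (intro emeasure_mono_AE) auto
  then show ?thesis using 1 by (rule order_trans)
qed

end

section \<open>Geometric decay of superlevel sets\<close>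

text \<open>The summands double, so their sum is at most twice the last one that is counted, and
  that one does not exceed \<open>y\<close>.\<close>

lemma dyadic_sum_le:
  fixes c y :: real
  assumes "0 < c" "0 \<le> y"
  shows "(\<Sum>k<K. if c * 2^k \<le> y then c * 2^k else 0) \<le> 2 * y"
proof (induction K)
  case (Suc K)
  show ?case
  proof (cases "c * 2^K \<le> y")
    case True
    have "(\<Sum>k<K. if c * 2^k \<le> y then c * 2^k else 0) \<le> (\<Sum>k<K. c * 2^k)"
      using \<open>0 < c\<close> by (intro sum_mono) auto
    also have "\<dots> \<le> c * 2^K"
      using \<open>0 < c\<close> by (simp add: sum_distrib_left[symmetric] geometric_sum[of 2])
    finally show ?thesis using True by simp
  qed (use Suc in simp)
qed (use assms in simp)

context A1_bound
begin

text \<open>The excess over 1 is calibrated for the absorption in \<open>superlevel_decay\<close>: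
  there it gets multiplied by \<open>4 * 2^CARD('n) * A\<close>, and the product is 1/2.\<close>

definition \<rho> :: real where
  "\<rho> = 1 + 1 / (8 * 2^CARD('n) * A)"

lemma \<rho>_gt_1: "1 < \<rho>"
  using A_ge_1 by (simp add: \<rho>_def)

lemma \<rho>_minus_1: "(\<rho> - 1) * (8 * 2^CARD('n) * A) = 1"
  using A_ge_1 by (simp add: \<rho>_def)

text \<open>Comparing \<open>A * u\<close> with \<open>u\<close> shifts heights by \<open>p\<close>
  dyadic levels, which is harmless as long as \<open>\<rho>^p\<close> stays bounded. Taking
  \<open>p\<close> near \<open>A\<close> instead of near its logarithm suffices, because
  \<open>\<rho> - 1\<close> is of order \<open>1 / A\<close>.\<close>

lemma \<rho>_power_le_2:
  obtains p where "A < 2^p" "\<rho>^p \<le> 2"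
proof -
  define p where "p = nat \<lceil>A\<rceil>"
  have p: "A \<le> real p" "real p \<le> 2 * A" using A_ge_1 unfolding p_def by linarith+
  have "real p * (\<rho> - 1) \<le> 2 * A * (\<rho> - 1)"
    using p \<rho>_gt_1 by (intro mult_right_mono) auto
  also have "\<dots> \<le> (\<rho> - 1) * (8 * 2^CARD('n) * A) / 2"
  proof -
    have "(1 :: real) \<le> 2^CARD('n)" by simp
    then have "(\<rho> - 1) * A * 2 \<le> (\<rho> - 1) * A * (4 * 2^CARD('n))"
      using A_ge_1 \<rho>_gt_1 by (intro mult_left_mono mult_nonneg_nonneg) linarith+
    then show ?thesis by (simp only: mult_ac)
  qed
  also have "\<dots> = 1 / 2" by (simp only: \<rho>_minus_1)
  finally have le: "real p * (\<rho> - 1) \<le> 1 / 2" .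
  have "\<rho> \<le> exp (\<rho> - 1)" using exp_ge_add_one_self[of "\<rho> - 1"] by simp
  then have "\<rho>^p \<le> exp (\<rho> - 1)^p" using \<rho>_gt_1 by (intro power_mono) auto
  also have "\<dots> = exp (real p * (\<rho> - 1))" by (simp add: exp_of_nat_mult)
  also have "\<dots> \<le> exp (1 / 2)" using le by simp
  also have "\<dots> \<le> 2"
  proof -
    have "1 / 2 \<le> exp (- (1 / 2) :: real)" using exp_ge_add_one_self[of "- (1 / 2) :: real"] by simp
    then show ?thesis by (simp add: exp_minus field_simps)
  qed
  finally have "\<rho>^p \<le> 2" .
  moreover have "A < 2^p" using p(1) of_nat_less_two_power[of p, where 'a=real] by linarith
  ultimately show thesis using that by blast
qed

text \<open>Chebyshev's inequality for \<open>u\<close> alone would give decay like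
  \<open>1 / 2^k\<close>. It is applied instead to \<open>u * \<Psi>\<close>, whose integral over
  the cube is still at most \<open>2 * \<alpha> * l ^ CARD('n)\<close>, while on the superlevel set
  this product is at least \<open>\<alpha> * (2 * \<rho>)^k\<close>.\<close>

lemma superlevel_decay:
  assumes "0 < l" "0 < \<alpha>" and Q: "emeasure \<nu> (hcube a l) \<le> ennreal (\<alpha> * l ^ CARD('n))"
  shows "emeasure lebesgue {x \<in> hcube a l. \<alpha> * 2^k < u x} \<le> ennreal (2 * l ^ CARD('n) / (2 * \<rho>)^k)"
proof -
  \<comment> \<open>One more than \<open>k\<close>, so that the height \<open>\<alpha> * 2^k\<close>
    itself is counted and \<open>\<Psi>_ge\<close> applies with \<open>j = k\<close>.\<close>
  define K where "K = Suc k"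
  define d where "d = \<rho> - 1"
  have d: "0 < d" "\<rho> = 1 + d" "d * (8 * 2^CARD('n) * A) = 1"
    using \<rho>_gt_1 \<rho>_minus_1 by (auto simp: d_def)
  \<comment> \<open>\<open>\<Psi> x\<close> equals \<open>\<rho>\<close> to the number of \<open>j < K\<close> with \<open>\<alpha> * 2^j < u x\<close>; testing the reverse weak type
     inequality against it reproduces half of the integral of \<open>u * \<Psi>\<close>, which is then absorbed.\<close>
  define \<Psi> where "\<Psi> x = 1 + (\<Sum>j<K. d * \<rho>^j * (if \<alpha> * 2^j < u x then 1 else 0))" for x
  have geo: "1 + (\<Sum>i<j. d * \<rho>^i) = \<rho>^j" for j
    by (induction j) (auto simp: d algebra_simps)
  have [measurable]: "\<Psi> \<in> borel_measurable lebesgue" unfolding \<Psi>_def by measurable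
  have \<Psi>_ge_1: "1 \<le> \<Psi> x" for x
    unfolding \<Psi>_def using d \<rho>_gt_1 by (auto intro!: sum_nonneg)
  have \<Psi>_le: "\<Psi> x \<le> \<rho>^K" for x
    unfolding \<Psi>_def geo[of K, symmetric] using d \<rho>_gt_1 by (auto intro!: sum_mono)
  have \<Psi>_ge: "\<rho>^j \<le> \<Psi> x" if "j < K" "\<alpha> * 2^j < u x" for j x
  proof -
    have "\<alpha> * 2^i < u x" if "i < j" for i
    proof -
      have "\<alpha> * 2^i \<le> \<alpha> * 2^j" using that \<open>0 < \<alpha>\<close> by (intro mult_left_mono power_increasing) auto
      then show ?thesis using \<open>\<alpha> * 2^j < u x\<close> by linarith
    qed
    then have "(\<Sum>i<j. d * \<rho>^i) = (\<Sum>i<j. d * \<rho>^i * (if \<alpha> * 2^i < u x then 1 else 0))"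
      by (intro sum.cong) auto
    also have "\<dots> \<le> (\<Sum>i<K. d * \<rho>^i * (if \<alpha> * 2^i < u x then 1 else 0))"
      using \<open>j < K\<close> d \<rho>_gt_1 by (intro sum_mono2) auto
    finally show ?thesis unfolding \<Psi>_def geo[of j, symmetric] by simp
  qed
  obtain p where p: "A < 2^p" "\<rho>^p \<le> 2" by (rule \<rho>_power_le_2)
  \<comment> \<open>Below \<open>p\<close> the power \<open>\<rho>^j\<close> is at most 2 by itself.
    From \<open>p\<close> on, \<open>\<alpha> * 2^j \<le> A * u x\<close> implies
    \<open>\<alpha> * 2^(j - p) < u x\<close>, and the lost levels cost only
    \<open>\<rho>^p \<le> 2\<close>.\<close>
  have \<rho>_le: "\<rho>^j \<le> 2 * \<Psi> x" if "j < K" "\<alpha> * 2^j \<le> A * u x" for j x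
  proof (cases "j < p")
    case True
    then have "\<rho>^j \<le> \<rho>^p" using \<rho>_gt_1 by (intro power_increasing) auto
    then show ?thesis using p(2) \<Psi>_ge_1[of x] by linarith
  next
    case False
    then have j: "j = (j - p) + p" by simp
    have "0 < \<alpha> * 2^j" using \<open>0 < \<alpha>\<close> by simp
    then have "0 < A * u x" using that by linarith
    then have "0 < u x" using A_ge_1 by (simp add: zero_less_mult_iff)
    then have "A * u x < 2^p * u x" using p by simp
    then have "\<alpha> * 2^((j - p) + p) < u x * 2^p" using that(2) j by (simp add: mult.commute)
    then have "(\<alpha> * 2^(j - p)) * 2^p < u x * 2^p" unfolding power_add by (simp only: mult.assoc)
    then have "\<alpha> * 2^(j - p) < u x" by (rule mult_right_less_imp_less) simp
    then have "\<rho>^(j - p) \<le> \<Psi> x" using \<open>j < K\<close> by (intro \<Psi>_ge) auto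
    then have "\<rho>^(j - p) * \<rho>^p \<le> \<Psi> x * 2" using p(2) \<Psi>_ge_1[of x] \<rho>_gt_1 by (intro mult_mono) auto
    then show ?thesis using j by (simp add: power_add[symmetric])
  qed
  \<comment> \<open>After \<open>\<rho>^j\<close> is replaced by \<open>2 * \<Psi> x\<close>, a
    doubling sum of heights up to \<open>A * u x\<close> remains. Its bound
    \<open>2 * (A * u x)\<close> and the choice of \<open>\<rho>\<close> produce the factor
    1/2.\<close>
  have pointwise: "(\<Sum>j<K. d * \<rho>^j * (2^CARD('n) * (\<alpha> * 2^j)) * (if \<alpha> * 2^j \<le> A * u x then 1 else 0))
      \<le> u x * \<Psi> x / 2" for x
  proof -
    have "(\<Sum>j<K. d * \<rho>^j * (2^CARD('n) * (\<alpha> * 2^j)) * (if \<alpha> * 2^j \<le> A * u x then 1 else 0))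
        \<le> (\<Sum>j<K. (d * 2^CARD('n) * (2 * \<Psi> x)) * (if \<alpha> * 2^j \<le> A * u x then \<alpha> * 2^j else 0))"
    proof (rule sum_mono)
      fix j assume "j \<in> {..<K}"
      then have "\<alpha> * 2^j \<le> A * u x \<Longrightarrow> (d * 2^CARD('n) * (\<alpha> * 2^j)) * \<rho>^j \<le> (d * 2^CARD('n) * (\<alpha> * 2^j)) * (2 * \<Psi> x)"
        using d \<open>0 < \<alpha>\<close> by (intro mult_left_mono \<rho>_le) auto
      then show "d * \<rho>^j * (2^CARD('n) * (\<alpha> * 2^j)) * (if \<alpha> * 2^j \<le> A * u x then 1 else 0)
        \<le> (d * 2^CARD('n) * (2 * \<Psi> x)) * (if \<alpha> * 2^j \<le> A * u x then \<alpha> * 2^j else 0)"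
        by (auto simp: mult_ac)
    qed
    also have "\<dots> \<le> (d * 2^CARD('n) * (2 * \<Psi> x)) * (2 * (A * u x))"
      unfolding sum_distrib_left[symmetric]
      using d \<Psi>_ge_1[of x] A_ge_1 u_nonneg[of x] \<open>0 < \<alpha>\<close> by (intro mult_left_mono dyadic_sum_le) auto
    also have "\<dots> = (d * (8 * 2^CARD('n) * A)) * (u x * \<Psi> x / 2)" by simp
    finally show ?thesis unfolding d by simp
  qed
  define X where "X = (\<integral>\<^sup>+x. ennreal (u x * \<Psi> x) * indicator (hcube a l) x \<partial>lebesgue)"
  define S where "S j = {x \<in> hcube a l. \<alpha> * 2^j < u x}" for j :: nat
  define T where "T j = {x \<in> hcube a l. \<alpha> * 2^j \<le> A * u x}" for j :: nat
  have [measurable]: "S j \<in> sets lebesgue" "T j \<in> sets lebesgue" for j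
    unfolding S_def T_def by measurable
  have weak: "emeasure \<nu> (S j) \<le> ennreal (2^CARD('n) * (\<alpha> * 2^j)) * emeasure lebesgue (T j)" for j
    unfolding S_def T_def
  proof (rule reverse_weak_type[OF \<open>0 < l\<close>])
    have "\<alpha> * l ^ CARD('n) * 1 \<le> \<alpha> * l ^ CARD('n) * 2^j"
      using \<open>0 < l\<close> \<open>0 < \<alpha>\<close> by (intro mult_left_mono) auto
    then show "emeasure \<nu> (hcube a l) \<le> ennreal (\<alpha> * 2^j * l ^ CARD('n))"
      by (intro order_trans[OF Q ennreal_leI]) (simp add: mult_ac)
  qed (use \<open>0 < \<alpha>\<close> in simp)
  \<comment> \<open>Expanding \<open>\<Psi>\<close> layer by layer expresses \<open>X\<close>
    through the masses of the sets \<open>S j\<close>, to which \<open>weak\<close> applies.\<close>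
  have "X = (\<integral>\<^sup>+x. ennreal (u x) * indicator (hcube a l) x
      + (\<Sum>j<K. ennreal (d * \<rho>^j) * (ennreal (u x) * indicator (S j) x)) \<partial>lebesgue)"
    unfolding X_def
  proof (rule nn_integral_cong)
    fix x
    show "ennreal (u x * \<Psi> x) * indicator (hcube a l) x = ennreal (u x) * indicator (hcube a l) x
      + (\<Sum>j<K. ennreal (d * \<rho>^j) * (ennreal (u x) * indicator (S j) x))"
    proof (cases "x \<in> hcube a l")
      case True
      have "(\<Sum>j<K. ennreal (d * \<rho>^j) * (ennreal (u x) * indicator (S j) x))
          = (\<Sum>j<K. ennreal (d * \<rho>^j * (u x * (if \<alpha> * 2^j < u x then 1 else 0))))"
        using True u_nonneg[of x] d \<rho>_gt_1 by (intro sum.cong) (auto simp: S_def ennreal_mult)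
      also have "\<dots> = ennreal (\<Sum>j<K. d * \<rho>^j * (u x * (if \<alpha> * 2^j < u x then 1 else 0)))"
        using u_nonneg[of x] d \<rho>_gt_1 by (intro sum_ennreal) auto
      also have "(\<Sum>j<K. d * \<rho>^j * (u x * (if \<alpha> * 2^j < u x then 1 else 0))) = u x * (\<Psi> x - 1)"
        unfolding \<Psi>_def by (simp add: sum_distrib_left mult_ac)
      finally have "ennreal (u x) + (\<Sum>j<K. ennreal (d * \<rho>^j) * (ennreal (u x) * indicator (S j) x))
          = ennreal (u x + u x * (\<Psi> x - 1))"
        using u_nonneg[of x] \<Psi>_ge_1[of x] by simp
      then show ?thesis using True by (simp add: algebra_simps)
    qed (simp add: S_def)
  qed
  also have "\<dots> = emeasure \<nu> (hcube a l) + (\<Sum>j<K. ennreal (d * \<rho>^j) * emeasure \<nu> (S j))"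
    by (simp add: nn_integral_add nn_integral_sum nn_integral_cmult emeasure_density)
  also have "\<dots> \<le> ennreal (\<alpha> * l ^ CARD('n))
      + (\<Sum>j<K. ennreal (d * \<rho>^j) * (ennreal (2^CARD('n) * (\<alpha> * 2^j)) * emeasure lebesgue (T j)))"
    by (intro add_mono Q sum_mono mult_left_mono weak) auto
  also have "(\<Sum>j<K. ennreal (d * \<rho>^j) * (ennreal (2^CARD('n) * (\<alpha> * 2^j)) * emeasure lebesgue (T j)))
      = (\<integral>\<^sup>+x. (\<Sum>j<K. ennreal (d * \<rho>^j) * (ennreal (2^CARD('n) * (\<alpha> * 2^j)) * indicator (T j) x)) \<partial>lebesgue)"
    by (simp add: nn_integral_sum nn_integral_cmult)
  also have "\<dots> \<le> (\<integral>\<^sup>+x. ennreal (1 / 2) * (ennreal (u x * \<Psi> x) * indicator (hcube a l) x) \<partial>lebesgue)"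
  proof (rule nn_integral_mono)
    fix x
    show "(\<Sum>j<K. ennreal (d * \<rho>^j) * (ennreal (2^CARD('n) * (\<alpha> * 2^j)) * indicator (T j) x))
      \<le> ennreal (1 / 2) * (ennreal (u x * \<Psi> x) * indicator (hcube a l) x)"
    proof (cases "x \<in> hcube a l")
      case True
      have "(\<Sum>j<K. ennreal (d * \<rho>^j) * (ennreal (2^CARD('n) * (\<alpha> * 2^j)) * indicator (T j) x))
        = (\<Sum>j<K. ennreal (d * \<rho>^j * (2^CARD('n) * (\<alpha> * 2^j)) * (if \<alpha> * 2^j \<le> A * u x then 1 else 0)))"
        using True d \<rho>_gt_1 \<open>0 < \<alpha>\<close> by (intro sum.cong) (auto simp: T_def ennreal_mult)
      also have "\<dots> = ennreal (\<Sum>j<K. d * \<rho>^j * (2^CARD('n) * (\<alpha> * 2^j)) * (if \<alpha> * 2^j \<le> A * u x then 1 else 0))"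
        using d \<rho>_gt_1 \<open>0 < \<alpha>\<close> by (intro sum_ennreal) auto
      also have "\<dots> \<le> ennreal (1 / 2 * (u x * \<Psi> x))"
        using pointwise[of x] by (intro ennreal_leI) simp
      also have "\<dots> = ennreal (1 / 2) * ennreal (u x * \<Psi> x)"
        using u_nonneg[of x] \<Psi>_ge_1[of x] by (intro ennreal_mult) auto
      finally show ?thesis using True by simp
    qed (simp add: T_def)
  qed
  also have "\<dots> = ennreal (1 / 2) * X"
    unfolding X_def by (rule nn_integral_cmult) measurable
  finally have absorb: "X \<le> ennreal (\<alpha> * l ^ CARD('n)) + ennreal (1 / 2) * X"
    by (simp add: add_left_mono)
  \<comment> \<open>Half of \<open>X\<close> can be absorbed only if \<open>X\<close> is finite;
    this follows from the crude bound on \<open>\<Psi>\<close>, which depends on \<open>k\<close>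
    but does not enter the result.\<close>
  have "X \<le> (\<integral>\<^sup>+x. ennreal (\<rho>^K) * (ennreal (u x) * indicator (hcube a l) x) \<partial>lebesgue)"
    unfolding X_def
  proof (rule nn_integral_mono)
    fix x
    have "u x * \<Psi> x \<le> \<rho>^K * u x" using mult_right_mono[OF \<Psi>_le u_nonneg] by (simp add: mult.commute)
    then have "ennreal (u x * \<Psi> x) \<le> ennreal (\<rho>^K) * ennreal (u x)"
      using u_nonneg[of x] \<rho>_gt_1 by (simp add: ennreal_mult[symmetric] ennreal_leI)
    then show "ennreal (u x * \<Psi> x) * indicator (hcube a l) x \<le> ennreal (\<rho>^K) * (ennreal (u x) * indicator (hcube a l) x)"
      by (simp split: split_indicator)
  qed
  also have "\<dots> = ennreal (\<rho>^K) * emeasure \<nu> (hcube a l)"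
    by (simp add: nn_integral_cmult emeasure_density)
  also have "\<dots> < \<infinity>" using finite_hcube[of a l] by (simp add: ennreal_mult_less_top)
  finally have "X < \<infinity>" .
  then obtain X' where X': "X = ennreal X'" "0 \<le> X'" by (cases X) auto
  have "X' \<le> \<alpha> * l ^ CARD('n) + 1 / 2 * X'"
  proof -
    have "ennreal (1 / 2) * X = ennreal (1 / 2 * X')"
      unfolding X' using X'(2) by (intro ennreal_mult[symmetric]) auto
    moreover have "0 \<le> \<alpha> * l ^ CARD('n)" "0 \<le> 1 / 2 * X'" using \<open>0 < l\<close> \<open>0 < \<alpha>\<close> X'(2) by auto
    ultimately have "ennreal X' \<le> ennreal (\<alpha> * l ^ CARD('n) + 1 / 2 * X')"
      using absorb unfolding X'(1) by (simp only: ennreal_plus)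
    then show ?thesis
      using \<open>0 \<le> \<alpha> * l ^ CARD('n)\<close> \<open>0 \<le> 1 / 2 * X'\<close> by (subst (asm) ennreal_le_iff) (intro add_nonneg_nonneg; assumption)
  qed
  then have X: "X \<le> ennreal (2 * \<alpha> * l ^ CARD('n))" using X' by (simp add: ennreal_leI)
  have "ennreal (\<alpha> * (2 * \<rho>)^k) * emeasure lebesgue (S k)
      = (\<integral>\<^sup>+x. ennreal (\<alpha> * (2 * \<rho>)^k) * indicator (S k) x \<partial>lebesgue)"
    by (simp add: nn_integral_cmult_indicator)
  also have "\<dots> \<le> X"
    unfolding X_def
  proof (rule nn_integral_mono)
    fix x
    have "\<alpha> * (2 * \<rho>)^k \<le> u x * \<Psi> x" if "x \<in> S k"
    proof -
      have "\<alpha> * 2^k * \<rho>^k \<le> u x * \<Psi> x"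
        using that \<Psi>_ge[of k x] \<rho>_gt_1 u_nonneg[of x] unfolding S_def K_def
        by (intro mult_mono) auto
      then show ?thesis by (simp add: power_mult_distrib mult.assoc)
    qed
    then show "ennreal (\<alpha> * (2 * \<rho>)^k) * indicator (S k) x \<le> ennreal (u x * \<Psi> x) * indicator (hcube a l) x"
      by (auto split: split_indicator simp: ennreal_leI) (auto simp: S_def)
  qed
  also note X
  finally have le: "ennreal (\<alpha> * (2 * \<rho>)^k) * emeasure lebesgue (S k) \<le> ennreal (2 * \<alpha> * l ^ CARD('n))" .
  have pos: "0 < \<alpha> * (2 * \<rho>)^k" using \<open>0 < \<alpha>\<close> \<rho>_gt_1 by simp
  have "emeasure lebesgue (S k) \<le> ennreal (l ^ CARD('n))"
    unfolding emeasure_hcube[OF \<open>0 < l\<close>, of a, symmetric] by (rule emeasure_mono) (auto simp: S_def)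
  then obtain s where s: "emeasure lebesgue (S k) = ennreal s" "0 \<le> s"
    by (cases "emeasure lebesgue (S k)") (auto simp: top_unique)
  have "\<alpha> * (2 * \<rho>)^k * s \<le> 2 * \<alpha> * l ^ CARD('n)"
    using le s pos \<open>0 < l\<close> \<open>0 < \<alpha>\<close> by (simp add: ennreal_mult[symmetric] del: emeasure_completion)
  then have "s \<le> 2 * l ^ CARD('n) / (2 * \<rho>)^k"
    using \<open>0 < \<alpha>\<close> \<rho>_gt_1 by (simp add: field_simps)
  then show ?thesis using s unfolding S_def by (simp add: ennreal_leI del: emeasure_completion)
qed

end

section \<open>Vitali covering with recorded proportions\<close>

lemma ball_subset_hcube:
  fixes c :: "real^'n"
  assumes "0 < r"
  shows "ball c r \<subseteq> hcube (\<chi> i. c $ i - 2 * r) (4 * r)"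
proof
  fix y assume "y \<in> ball c r"
  then have "norm (c - y) < r" by (simp add: dist_norm)
  then have "\<bar>c $ i - y $ i\<bar> < r" for i
    using component_le_norm_cart[of "c - y" i] by simp
  then have "c $ i - 2 * r \<le> y $ i \<and> y $ i < c $ i + 2 * r" for i
    using \<open>0 < r\<close> unfolding abs_less_iff by (smt (verit))
  then show "y \<in> hcube (\<chi> i. c $ i - 2 * r) (4 * r)" by (auto simp: hcube_def algebra_simps)
qed

text \<open>On a selected ball, \<open>q\<close> is the proportion of \<open>F\<close> in a cube
  around the fivefold dilate. The part of \<open>F\<close> in that cube, times
  \<open>\<tau>\<close>, is then at most 20^n times the integral of \<open>g * q\<close> over the
  ball, and these integrals add up by disjointness. Retaining the proportion, rather than bounding
  it by 1, is what lets \<open>level_sum_le\<close> sum over many sets \<open>F\<close>.\<close>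

lemma vitali_average:
  fixes F :: "(real^'n) set" and g :: "real^'n \<Rightarrow> ennreal"
  assumes F [measurable]: "F \<in> sets lebesgue" and g [measurable]: "g \<in> borel_measurable lebesgue"
    and "0 < \<tau>"
    and cover: "\<And>x. x \<in> F \<Longrightarrow> \<exists>c r. 0 < r \<and> r \<le> B \<and> x \<in> ball c r \<and>
      ennreal (\<tau> * r ^ CARD('n)) \<le> (\<integral>\<^sup>+y\<in>ball c r. g y \<partial>lebesgue)"
  obtains q :: "real^'n \<Rightarrow> ennreal" where "q \<in> borel_measurable lebesgue"
    "\<And>y. q y = 0 \<or> (\<exists>a l. 0 < l \<and> y \<in> hcube a l \<and>
      ennreal (l ^ CARD('n)) * q y = emeasure lebesgue (F \<inter> hcube a l))"
    "ennreal \<tau> * emeasure lebesgue F \<le> ennreal (20 ^ CARD('n)) * (\<integral>\<^sup>+y. g y * q y \<partial>lebesgue)"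
proof -
  define K where "K = {(c, r). 0 < r \<and> r \<le> B \<and>
    ennreal (\<tau> * r ^ CARD('n)) \<le> (\<integral>\<^sup>+y\<in>ball (c :: real^'n) r. g y \<partial>lebesgue)}"
  have "F \<subseteq> (\<Union>i\<in>K. ball (fst i) (snd i))"
  proof
    fix x assume "x \<in> F"
    then obtain c r where "(c, r) \<in> K" "x \<in> ball c r" using cover unfolding K_def by blast
    then show "x \<in> (\<Union>i\<in>K. ball (fst i) (snd i))" by force
  qed
  moreover have "0 < snd i \<and> snd i \<le> B" if "i \<in> K" for i using that by (auto simp: K_def)
  ultimately obtain C where C: "countable C" "C \<subseteq> K"
    and disj: "pairwise (\<lambda>i j. disjnt (ball (fst i) (snd i)) (ball (fst j) (snd j))) C"
    and cov: "F \<subseteq> (\<Union>i\<in>C. ball (fst i) (5 * snd i))"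
    by (rule Vitali_covering_lemma_balls) (assumption | rule that)+
  have pos: "0 < snd i" if "i \<in> C" for i using that C(2) by (auto simp: K_def)
  define V where "V i = ball (fst i :: real^'n) (snd i)" for i
  \<comment> \<open>The factor 20 is 5 from the Vitali dilation times 4 from
    \<open>ball_subset_hcube\<close>.\<close>
  define L where "L i = 20 * (snd i :: real)" for i :: "(real^'n) \<times> real"
  define H where "H i = hcube (\<chi> j. fst i $ j - 2 * (5 * snd i)) (L i)" for i :: "(real^'n) \<times> real"
  define v where "v i = emeasure lebesgue (F \<inter> H i) / ennreal (L i ^ CARD('n))" for i
  \<comment> \<open>By disjointness at most one term is nonzero at each point; a countable supremum
    makes measurability immediate.\<close>
  define q where "q y = (SUP i\<in>C. v i * indicator (V i) y)" for y
  have [measurable]: "H i \<in> sets lebesgue" "V i \<in> sets lebesgue" for i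
    unfolding H_def V_def by (auto intro: lebesgue_hcube)
  have V_sub: "V i \<subseteq> ball (fst i) (5 * snd i)" if "i \<in> C" for i
    unfolding V_def using pos[OF that] by (intro subset_ball) simp
  have ball_H: "ball (fst i) (5 * snd i) \<subseteq> H i" if "i \<in> C" for i
    using ball_subset_hcube[of "5 * snd i" "fst i"] pos[OF that] unfolding H_def L_def by simp
  have v: "ennreal (L i ^ CARD('n)) * v i = emeasure lebesgue (F \<inter> H i)" if "i \<in> C" for i
    unfolding v_def using pos[OF that]
    by (simp add: L_def ennreal_times_divide mult_divide_eq_ennreal mult.commute del: emeasure_completion)
  have q_V: "q y = v i" if "i \<in> C" "y \<in> V i" for i y
    unfolding q_def
  proof (rule antisym)
    have "v j * indicator (V j) y \<le> v i" if "j \<in> C" for j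
    proof (cases "j = i")
      case False
      then have "y \<notin> V j"
        using pairwiseD[OF disj \<open>j \<in> C\<close> \<open>i \<in> C\<close>] \<open>y \<in> V i\<close> by (auto simp: V_def disjnt_def)
      then show ?thesis by simp
    qed (simp split: split_indicator)
    then show "(SUP j\<in>C. v j * indicator (V j) y) \<le> v i" by (rule SUP_least)
    show "v i \<le> (SUP j\<in>C. v j * indicator (V j) y)"
      using that by (intro SUP_upper2[of i]) auto
  qed
  have q_0: "q y = 0" if "\<And>i. i \<in> C \<Longrightarrow> y \<notin> V i" for y
    unfolding q_def using that by (auto intro!: antisym SUP_least)
  have q_meas [measurable]: "q \<in> borel_measurable lebesgue"
    unfolding q_def using C(1) by (intro borel_measurable_SUP) auto
  show thesis
  proof (rule that)
    show "q y = 0 \<or> (\<exists>a l. 0 < l \<and> y \<in> hcube a l \<and>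
      ennreal (l ^ CARD('n)) * q y = emeasure lebesgue (F \<inter> hcube a l))" for y
    proof (cases "\<exists>i\<in>C. y \<in> V i")
      case True
      then obtain i where i: "i \<in> C" "y \<in> V i" by blast
      then have "0 < L i" "y \<in> H i" "ennreal (L i ^ CARD('n)) * q y = emeasure lebesgue (F \<inter> H i)"
        using pos[OF i(1)] V_sub[OF i(1)] ball_H[OF i(1)] v[OF i(1)] q_V[OF i] i(2)
        by (auto simp: L_def simp del: emeasure_completion)
      then show ?thesis unfolding H_def by blast
    qed (use q_0 in blast)
    define M where "M = density lebesgue (\<lambda>y. g y * q y)"
    have setsM [measurable_cong]: "sets M = sets lebesgue" by (simp add: M_def)
    have "emeasure lebesgue F = (\<integral>\<^sup>+x. indicator F x \<partial>lebesgue)" by simp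
    also have "\<dots> \<le> (\<integral>\<^sup>+x. \<integral>\<^sup>+i. indicator (F \<inter> H i) x \<partial>count_space C \<partial>lebesgue)"
    proof (rule nn_integral_mono)
      fix x
      show "indicator F x \<le> (\<integral>\<^sup>+i. indicator (F \<inter> H i) x \<partial>count_space C)"
      proof (cases "x \<in> F")
        case True
        then obtain i where "i \<in> C" "x \<in> H i" using cov ball_H by blast
        then show ?thesis
          using nn_integral_ge_point[of i C "\<lambda>i. indicator (F \<inter> H i) x"] True by simp
      qed simp
    qed
    also have "\<dots> = (\<integral>\<^sup>+i. emeasure lebesgue (F \<inter> H i) \<partial>count_space C)"
      by (subst nn_integral_count_space_nn_integral[OF C(1)]) (auto simp del: emeasure_completion)
    finally have "ennreal \<tau> * emeasure lebesgue F \<le> (\<integral>\<^sup>+i. ennreal \<tau> * emeasure lebesgue (F \<inter> H i) \<partial>count_space C)"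
      by (simp add: nn_integral_cmult mult_left_mono del: emeasure_completion)
    also have "\<dots> \<le> (\<integral>\<^sup>+i. ennreal (20 ^ CARD('n)) * emeasure M (V i) \<partial>count_space C)"
    proof (rule nn_integral_mono)
      fix i assume "i \<in> space (count_space C)"
      then have i: "i \<in> C" by simp
      have "ennreal \<tau> * emeasure lebesgue (F \<inter> H i) = ennreal (20 ^ CARD('n)) * (ennreal (\<tau> * snd i ^ CARD('n)) * v i)"
        unfolding v[OF i, symmetric] L_def using \<open>0 < \<tau>\<close> pos[OF i]
        by (simp add: power_mult_distrib ennreal_mult mult_ac)
      also have "\<dots> \<le> ennreal (20 ^ CARD('n)) * ((\<integral>\<^sup>+y\<in>V i. g y \<partial>lebesgue) * v i)"
        using i C(2) by (intro mult_left_mono mult_right_mono) (auto simp: K_def V_def)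
      also have "(\<integral>\<^sup>+y\<in>V i. g y \<partial>lebesgue) * v i = (\<integral>\<^sup>+y\<in>V i. g y * q y \<partial>lebesgue)"
        by (subst nn_integral_multc[symmetric])
          (auto intro!: nn_integral_cong simp: q_V[OF i] split: split_indicator)
      also have "\<dots> = emeasure M (V i)" unfolding M_def by (subst emeasure_density) auto
      finally show "ennreal \<tau> * emeasure lebesgue (F \<inter> H i) \<le> ennreal (20 ^ CARD('n)) * emeasure M (V i)" .
    qed
    also have "\<dots> = ennreal (20 ^ CARD('n)) * (\<integral>\<^sup>+i. emeasure M (V i) \<partial>count_space C)"
      by (rule nn_integral_cmult) simp
    also have "(\<integral>\<^sup>+i. emeasure M (V i) \<partial>count_space C) = emeasure M (\<Union>i\<in>C. V i)"
      using disj C(1) setsM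
      by (intro emeasure_UN_countable[symmetric]) (auto simp: disjoint_family_on_def pairwise_def disjnt_def V_def)
    also have "\<dots> \<le> emeasure M (space M)" by (rule emeasure_space)
    also have "\<dots> = (\<integral>\<^sup>+y. g y * q y \<partial>lebesgue)"
      unfolding M_def by (subst emeasure_density) (auto simp: space_density intro!: nn_integral_cong)
    finally show "ennreal \<tau> * emeasure lebesgue F \<le> ennreal (20 ^ CARD('n)) * (\<integral>\<^sup>+y. g y * q y \<partial>lebesgue)"
      by (simp add: mult_left_mono)
  qed (rule q_meas)
qed

section \<open>Summation over dyadic levels\<close>

context A1_bound
begin

text \<open>Above the threshold \<open>s = A * u y\<close>, the factor \<open>2^J k\<close> in the
  size of a level cancels against the decay in \<open>superlevel_decay\<close> and leaves
  \<open>(1 / \<rho>)^J k\<close>. That geometric series contributes one factor \<open>A\<close>,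
  and \<open>s\<close> the other. The constant is 38 = 2 + 4 * 9.\<close>

lemma level_sum_le:
  assumes "0 < \<beta>" "0 < u y"
    and avg: "\<And>a l. 0 < l \<Longrightarrow> y \<in> hcube a l \<Longrightarrow> emeasure \<nu> (hcube a l) \<le> ennreal (A * u y * l ^ CARD('n))"
    and F: "\<And>k. F k \<subseteq> {x. \<beta> * 2^k < u x}"
    and q: "\<And>k. q k = 0 \<or> (\<exists>a l. 0 < l \<and> y \<in> hcube a l \<and>
      ennreal (l ^ CARD('n)) * q k = emeasure lebesgue (F k \<inter> hcube a l))"
  shows "(\<Sum>k<K. ennreal (\<beta> * 2^k) * q k) \<le> ennreal (38 * 2^CARD('n) * A\<^sup>2 * u y)"
proof -
  define s where "s = A * u y"
  have s: "0 < s" using A_ge_1 \<open>0 < u y\<close> by (simp add: s_def)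
  \<comment> \<open>For levels with \<open>s \<le> \<beta> * 2^k\<close> this is the integer part of
    the base 2 logarithm of \<open>\<beta> * 2^k / s\<close>.\<close>
  define J where "J k = (LEAST j. \<beta> * 2^k < s * 2^Suc j)" for k :: nat
  have J_upper: "\<beta> * 2^k < s * 2^Suc (J k)" for k
  proof -
    obtain j where "\<beta> * 2^k / s < 2^j" using real_arch_pow[of 2] by auto
    then have "\<beta> * 2^k < s * 2^j" using s by (simp add: field_simps)
    also have "\<dots> \<le> s * 2^Suc j" using s by simp
    finally show ?thesis unfolding J_def by (rule LeastI)
  qed
  have J_lower: "s * 2^J k \<le> \<beta> * 2^k" if "s \<le> \<beta> * 2^k" for k
  proof (cases "J k")
    case (Suc j)
    then show ?thesis using not_less_Least[of j "\<lambda>j. \<beta> * 2^k < s * 2^Suc j"] by (simp add: J_def)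
  qed (use that in simp)
  define I where "I = {k \<in> {..<K}. s \<le> \<beta> * 2^k}"
  \<comment> \<open>Distinct levels differ by a factor of at least 2, so no two of them share a
    block from \<open>s * 2^j\<close> to \<open>s * 2^Suc j\<close>. The sum over \<open>k\<close>
    is therefore part of a single geometric series.\<close>
  have inj: "inj_on J I"
  proof (rule linorder_inj_onI')
    fix k k' assume k: "k \<in> I" "k' \<in> I" "k < k'"
    show "J k \<noteq> J k'"
    proof
      assume eq: "J k = J k'"
      have "s * 2^Suc (J k) \<le> \<beta> * 2^Suc k" using J_lower[of k] k by (simp add: I_def)
      also have "\<dots> \<le> \<beta> * 2^k'" using k \<open>0 < \<beta>\<close> by (intro mult_left_mono power_increasing) auto
      finally show False using J_upper[of k'] eq by simp
    qed
  qed
  \<comment> \<open>At \<open>\<beta> * 2^k = s\<close> both summands are present, which only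
    enlarges the bound.\<close>
  define w where "w k = (if \<beta> * 2^k \<le> s then \<beta> * 2^k else 0) + (if s \<le> \<beta> * 2^k then 4 * s * (1 / \<rho>)^J k else 0)" for k :: nat
  have w_nonneg: "0 \<le> w k" for k using s \<open>0 < \<beta>\<close> \<rho>_gt_1 by (simp add: w_def)
  have q_le: "ennreal (\<beta> * 2^k) * q k \<le> ennreal (w k)" for k
  proof (cases "q k = 0")
    case False
    then obtain a l where al: "0 < l" "y \<in> hcube a l"
      "ennreal (l ^ CARD('n)) * q k = emeasure lebesgue (F k \<inter> hcube a l)" using q by blast
    have cancel: "q k \<le> ennreal c" if "emeasure lebesgue (F k \<inter> hcube a l) \<le> ennreal (l ^ CARD('n) * c)" "0 \<le> c" for c
    proof -
      have "ennreal (l ^ CARD('n)) * q k \<le> ennreal (l ^ CARD('n)) * ennreal c"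
        unfolding al(3) using that \<open>0 < l\<close> by (simp add: ennreal_mult del: emeasure_completion)
      then show ?thesis using \<open>0 < l\<close> by (subst (asm) ennreal_mult_le_mult_iff) auto
    qed
    show ?thesis
    proof (cases "s \<le> \<beta> * 2^k")
      case True
      have sub: "F k \<inter> hcube a l \<subseteq> {x \<in> hcube a l. s * 2^J k < u x}"
        using F[of k] J_lower[OF True] by force
      have "emeasure lebesgue (F k \<inter> hcube a l) \<le> emeasure lebesgue {x \<in> hcube a l. s * 2^J k < u x}"
        by (rule emeasure_mono[OF sub]) measurable
      also have "\<dots> \<le> ennreal (2 * l ^ CARD('n) / (2 * \<rho>)^J k)"
        using avg[OF al(1,2)] by (intro superlevel_decay[OF al(1) s]) (simp add: s_def)
      finally have "q k \<le> ennreal (2 / (2 * \<rho>)^J k)"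
        using \<rho>_gt_1 by (intro cancel) (simp_all add: mult.commute)
      then have "ennreal (\<beta> * 2^k) * q k \<le> ennreal (s * 2^Suc (J k)) * ennreal (2 / (2 * \<rho>)^J k)"
        by (rule mult_mono[OF ennreal_leI[OF less_imp_le[OF J_upper]]]) auto
      also have "\<dots> = ennreal (4 * s * (1 / \<rho>)^J k)"
        using s \<rho>_gt_1 by (simp add: ennreal_mult[symmetric] power_mult_distrib power_divide)
      also have "\<dots> \<le> ennreal (w k)" using True \<open>0 < \<beta>\<close> s by (intro ennreal_leI) (simp add: w_def)
      finally show ?thesis .
    next
      case False
      have "emeasure lebesgue (F k \<inter> hcube a l) \<le> emeasure lebesgue (hcube a l)"
        by (rule emeasure_mono) auto
      then have "q k \<le> ennreal 1" by (intro cancel) (simp_all add: emeasure_hcube[OF al(1)] del: emeasure_completion)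
      then have "ennreal (\<beta> * 2^k) * q k \<le> ennreal (\<beta> * 2^k) * 1" by (intro mult_left_mono) auto
      also have "\<dots> = ennreal (w k)" using False by (simp add: w_def)
      finally show ?thesis .
    qed
  qed simp
  \<comment> \<open>The full series is \<open>\<rho> / (\<rho> - 1)\<close>, which equals
    \<open>8 * 2^CARD('n) * A + 1\<close>.\<close>
  have geo: "(\<Sum>j<m. (1 / \<rho>)^j) \<le> 9 * 2^CARD('n) * A" for m
  proof -
    have "(\<Sum>j<m. (1 / \<rho>)^j) * (1 - 1 / \<rho>) = 1 - (1 / \<rho>)^m"
      by (simp add: one_diff_power_eq mult.commute)
    also have "\<dots> \<le> 1" using \<rho>_gt_1 by simp
    finally have le: "(\<Sum>j<m. (1 / \<rho>)^j) * (\<rho> - 1) \<le> \<rho>" using \<rho>_gt_1 by (simp add: field_simps)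
    have "(\<Sum>j<m. (1 / \<rho>)^j) = (\<Sum>j<m. (1 / \<rho>)^j) * (\<rho> - 1) * (8 * 2^CARD('n) * A)"
      using \<rho>_minus_1 by (simp add: mult.assoc)
    also have "\<dots> \<le> \<rho> * (8 * 2^CARD('n) * A)" using A_ge_1 by (intro mult_right_mono le) auto
    also have "\<dots> = 8 * 2^CARD('n) * A + 1" using \<rho>_minus_1 by (simp add: algebra_simps)
    also have "\<dots> \<le> 9 * 2^CARD('n) * A"
      using A_ge_1 mult_mono[of 1 "2^CARD('n)" 1 A] by (simp add: mult.commute)
    finally show ?thesis .
  qed
  have "(\<Sum>k\<in>I. 4 * s * (1 / \<rho>)^J k) = 4 * s * (\<Sum>j\<in>J ` I. (1 / \<rho>)^j)"
    by (simp add: sum.reindex[OF inj] sum_distrib_left)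
  also have "\<dots> \<le> 4 * s * (\<Sum>j<Suc (Max (J ` I)). (1 / \<rho>)^j)"
    using s \<rho>_gt_1 by (intro mult_left_mono sum_mono2) (auto simp: I_def less_Suc_eq_le)
  also have "\<dots> \<le> 4 * s * (9 * 2^CARD('n) * A)" using s by (intro mult_left_mono geo) auto
  finally have upper: "(\<Sum>k\<in>I. 4 * s * (1 / \<rho>)^J k) \<le> 4 * s * (9 * 2^CARD('n) * A)" .
  have "(\<Sum>k<K. ennreal (\<beta> * 2^k) * q k) \<le> (\<Sum>k<K. ennreal (w k))" by (intro sum_mono q_le)
  also have "\<dots> = ennreal (\<Sum>k<K. w k)" using w_nonneg by (intro sum_ennreal) auto
  also have "(\<Sum>k<K. w k) = (\<Sum>k<K. if \<beta> * 2^k \<le> s then \<beta> * 2^k else 0) + (\<Sum>k\<in>I. 4 * s * (1 / \<rho>)^J k)"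
    by (simp only: w_def sum.distrib I_def sum.inter_filter[OF finite_lessThan])
  also have "\<dots> \<le> 2 * s + 4 * s * (9 * 2^CARD('n) * A)"
    using s by (intro add_mono dyadic_sum_le upper \<open>0 < \<beta>\<close>) auto
  also have "\<dots> \<le> 38 * 2^CARD('n) * A * s"
    using mult_mono[of 1 "2^CARD('n)" 1 A] A_ge_1 s by (simp add: mult.commute mult.left_commute)
  also have "\<dots> = 38 * 2^CARD('n) * A\<^sup>2 * u y" by (simp add: s_def power2_eq_square)
  finally show ?thesis by (simp add: ennreal_leI)
qed

end

section \<open>The weak type inequality\<close>

text \<open>An uncentred maximal function over balls in level-set form, normalised by
  \<open>r ^ CARD('n)\<close> instead of the volume. The cap \<open>B\<close> on the radii is what
  Vitali's lemma asks for; as a union of open balls the set is open for every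
  \<open>g\<close>.\<close>

definition large_average :: "(real^'n \<Rightarrow> ennreal) \<Rightarrow> real \<Rightarrow> real \<Rightarrow> (real^'n) set" where
  "large_average g \<sigma> B = {x. \<exists>c r. 0 < r \<and> r \<le> B \<and> x \<in> ball c r \<and>
     ennreal (\<sigma> * r ^ CARD('n)) \<le> (\<integral>\<^sup>+y\<in>ball c r. g y \<partial>lebesgue)}"

lemma open_large_average:
  fixes g :: "real^'n \<Rightarrow> ennreal"
  shows "open (large_average g \<sigma> B)"
proof -
  have "large_average g \<sigma> B = \<Union>{ball c r | c r. 0 < r \<and> r \<le> B \<and>
      ennreal (\<sigma> * r ^ CARD('n)) \<le> (\<integral>\<^sup>+y\<in>ball c r. g y \<partial>lebesgue)}"
    unfolding large_average_def by blast
  then show ?thesis by auto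
qed

lemma large_average_measurable [measurable]: "large_average g \<sigma> B \<in> sets lebesgue"
  using open_large_average[of g \<sigma> B] by auto

lemma large_average_mono:
  assumes "B \<le> B'"
  shows "large_average g \<sigma> B \<subseteq> large_average g \<sigma> B'"
  using assms unfolding large_average_def by force

text \<open>Bounding the Euclidean norm by the sum of the coordinates places a cube of side
  \<open>l\<close> inside the ball about its centre of radius \<open>real CARD('n) * l\<close>; this
  enlargement costs n^n in the height.\<close>

lemma large_average_of_cube:
  fixes a :: "real^'n"
  assumes "0 < l" "0 \<le> \<sigma>" "x \<in> cbox a (\<chi> i. a $ i + l)" "real CARD('n) * l \<le> B"
    and avg: "ennreal (real CARD('n) ^ CARD('n) * \<sigma> * l ^ CARD('n)) \<le>
      (\<integral>\<^sup>+y\<in>cbox a (\<chi> i. a $ i + l). g y \<partial>lebesgue)"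
  shows "x \<in> large_average g \<sigma> B"
proof -
  define c :: "real^'n" where "c = (\<chi> i. a $ i + l / 2)"
  define r where "r = real CARD('n) * l"
  have "cbox a (\<chi> i. a $ i + l) \<subseteq> ball c r"
  proof
    fix y assume y: "y \<in> cbox a (\<chi> i. a $ i + l)"
    have "\<bar>(c - y) $ i\<bar> \<le> l / 2" for i
    proof -
      have "a $ i \<le> y $ i" "y $ i \<le> a $ i + l" using y by (auto simp: mem_box_cart)
      then show ?thesis unfolding c_def by (simp add: abs_le_iff field_simps)
    qed
    then have "norm (c - y) \<le> (\<Sum>i\<in>(UNIV :: 'n set). l / 2)"
      by (intro order_trans[OF norm_le_l1_cart] sum_mono) auto
    also have "\<dots> < r" using \<open>0 < l\<close> by (simp add: r_def)
    finally show "y \<in> ball c r" by (simp add: dist_norm)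
  qed
  then have "x \<in> ball c r" "(\<integral>\<^sup>+y\<in>cbox a (\<chi> i. a $ i + l). g y \<partial>lebesgue) \<le> (\<integral>\<^sup>+y\<in>ball c r. g y \<partial>lebesgue)"
    using assms(3) by (auto intro!: nn_integral_mono split: split_indicator)
  moreover have eq: "\<sigma> * r ^ CARD('n) = real CARD('n) ^ CARD('n) * \<sigma> * l ^ CARD('n)"
    by (simp add: r_def power_mult_distrib)
  ultimately have "ennreal (\<sigma> * r ^ CARD('n)) \<le> (\<integral>\<^sup>+y\<in>ball c r. g y \<partial>lebesgue)"
    unfolding eq by (blast intro: order_trans[OF avg])
  moreover have "0 < r" "r \<le> B" using assms by (auto simp: r_def)
  ultimately show ?thesis using \<open>x \<in> ball c r\<close> unfolding large_average_def by blast
qed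

context A1_bound
begin

text \<open>On \<open>F k\<close> the density \<open>(u x)\<^sup>2\<close> is at most
  \<open>4 * (\<beta> * 2^k)\<^sup>2\<close>. One factor \<open>\<beta> * 2^k\<close> belongs to the
  height in \<open>vitali_average\<close>; the other becomes the weight of \<open>q k\<close> in
  \<open>level_sum_le\<close>, which is applied pointwise under the integral.\<close>

lemma weak_type_levels:
  fixes g :: "real^'n \<Rightarrow> ennreal" and B :: real
  assumes pos: "AE x in lebesgue. 0 < u x" and g [measurable]: "g \<in> borel_measurable lebesgue"
    and "0 < \<beta>" "0 < \<sigma>"
  defines "F \<equiv> \<lambda>k. {x \<in> large_average g (\<sigma> * (\<beta> * 2^k)) B. \<beta> * 2^k < u x \<and> u x \<le> \<beta> * 2^Suc k}"
  shows "ennreal \<sigma> * emeasure (sq_measure u) (\<Union>k<K. F k)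
    \<le> ennreal (152 * 40 ^ CARD('n) * A\<^sup>2) * (\<integral>\<^sup>+y. g y * ennreal (u y) \<partial>lebesgue)"
proof -
  have F [measurable]: "F k \<in> sets lebesgue" for k unfolding F_def by measurable
  have sub: "F k \<subseteq> {x. \<beta> * 2^k < u x}" for k unfolding F_def by auto
  define good where "good k q \<longleftrightarrow> q \<in> borel_measurable lebesgue \<and>
      (\<forall>y. q y = 0 \<or> (\<exists>a l. 0 < l \<and> y \<in> hcube a l \<and>
        ennreal (l ^ CARD('n)) * q y = emeasure lebesgue (F k \<inter> hcube a l))) \<and>
      ennreal (\<sigma> * (\<beta> * 2^k)) * emeasure lebesgue (F k) \<le> ennreal (20 ^ CARD('n)) * (\<integral>\<^sup>+y. g y * q y \<partial>lebesgue)"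
    for k and q :: "real^'n \<Rightarrow> ennreal"
  have "\<exists>q. good k q" for k
  proof -
    have "0 < \<sigma> * (\<beta> * 2^k)" using \<open>0 < \<beta>\<close> \<open>0 < \<sigma>\<close> by simp
    moreover have "\<exists>c r. 0 < r \<and> r \<le> B \<and> x \<in> ball c r \<and>
      ennreal (\<sigma> * (\<beta> * 2^k) * r ^ CARD('n)) \<le> (\<integral>\<^sup>+y\<in>ball c r. g y \<partial>lebesgue)" if "x \<in> F k" for x
      using that unfolding F_def large_average_def by blast
    ultimately obtain q :: "real^'n \<Rightarrow> ennreal" where "q \<in> borel_measurable lebesgue"
      "\<And>y. q y = 0 \<or> (\<exists>a l. 0 < l \<and> y \<in> hcube a l \<and>
        ennreal (l ^ CARD('n)) * q y = emeasure lebesgue (F k \<inter> hcube a l))"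
      "ennreal (\<sigma> * (\<beta> * 2^k)) * emeasure lebesgue (F k) \<le> ennreal (20 ^ CARD('n)) * (\<integral>\<^sup>+y. g y * q y \<partial>lebesgue)"
      by (rule vitali_average[OF F g]) (assumption | rule that)+
    then have "good k q" unfolding good_def by (intro conjI allI)
    then show ?thesis by (rule exI[of "good k" q])
  qed
  then obtain q where good: "\<And>k. good k (q k)" by metis
  have q [measurable]: "q k \<in> borel_measurable lebesgue" for k
    using good[of k] unfolding good_def by (elim conjE)
  have q_avg: "q k y = 0 \<or> (\<exists>a l. 0 < l \<and> y \<in> hcube a l \<and>
        ennreal (l ^ CARD('n)) * q k y = emeasure lebesgue (F k \<inter> hcube a l))" for k y
    using good[of k] unfolding good_def by (elim conjE) (erule spec)
  have q_le: "ennreal (\<sigma> * (\<beta> * 2^k)) * emeasure lebesgue (F k)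
        \<le> ennreal (20 ^ CARD('n)) * (\<integral>\<^sup>+y. g y * q k y \<partial>lebesgue)" for k
    using good[of k] unfolding good_def by (elim conjE)
  have level: "ennreal \<sigma> * emeasure (sq_measure u) (F k)
      \<le> ennreal (4 * 20 ^ CARD('n)) * (\<integral>\<^sup>+y. g y * (ennreal (\<beta> * 2^k) * q k y) \<partial>lebesgue)" for k
  proof -
    have "emeasure (sq_measure u) (F k) = (\<integral>\<^sup>+x. ennreal ((u x)\<^sup>2) * indicator (F k) x \<partial>lebesgue)"
      unfolding sq_measure_def by (subst emeasure_density) auto
    also have "\<dots> \<le> (\<integral>\<^sup>+x. ennreal ((\<beta> * 2^Suc k)\<^sup>2) * indicator (F k) x \<partial>lebesgue)"
      using u_nonneg by (intro nn_integral_mono) (auto simp: F_def intro!: ennreal_leI power_mono split: split_indicator)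
    also have "\<dots> = ennreal ((\<beta> * 2^Suc k)\<^sup>2) * emeasure lebesgue (F k)"
      by (rule nn_integral_cmult_indicator) (rule F)
    finally have "ennreal \<sigma> * emeasure (sq_measure u) (F k)
        \<le> ennreal \<sigma> * (ennreal ((\<beta> * 2^Suc k)\<^sup>2) * emeasure lebesgue (F k))"
      by (intro mult_left_mono) auto
    also have "\<dots> = ennreal (4 * (\<beta> * 2^k)) * (ennreal (\<sigma> * (\<beta> * 2^k)) * emeasure lebesgue (F k))"
    proof -
      have "\<sigma> * (\<beta> * 2^Suc k)\<^sup>2 = 4 * (\<beta> * 2^k) * (\<sigma> * (\<beta> * 2^k))" by (simp add: power2_eq_square)
      then have "ennreal \<sigma> * ennreal ((\<beta> * 2^Suc k)\<^sup>2) = ennreal (4 * (\<beta> * 2^k)) * ennreal (\<sigma> * (\<beta> * 2^k))"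
        using \<open>0 < \<beta>\<close> \<open>0 < \<sigma>\<close> by (subst (1 2) ennreal_mult[symmetric]) auto
      then show ?thesis by (simp only: mult.assoc[symmetric])
    qed
    also have "\<dots> \<le> ennreal (4 * (\<beta> * 2^k)) * (ennreal (20 ^ CARD('n)) * (\<integral>\<^sup>+y. g y * q k y \<partial>lebesgue))"
      by (intro mult_left_mono q_le) auto
    also have "\<dots> = ennreal (4 * 20 ^ CARD('n)) * (ennreal (\<beta> * 2^k) * (\<integral>\<^sup>+y. g y * q k y \<partial>lebesgue))"
    proof -
      have "4 * (\<beta> * 2^k) * 20 ^ CARD('n) = 4 * 20 ^ CARD('n) * (\<beta> * 2^k)" by simp
      then have "ennreal (4 * (\<beta> * 2^k)) * ennreal (20 ^ CARD('n)) = ennreal (4 * 20 ^ CARD('n)) * ennreal (\<beta> * 2^k)"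
        using \<open>0 < \<beta>\<close> by (subst (1 2) ennreal_mult[symmetric]) auto
      then show ?thesis by (simp only: mult.assoc[symmetric])
    qed
    also have "ennreal (\<beta> * 2^k) * (\<integral>\<^sup>+y. g y * q k y \<partial>lebesgue) = (\<integral>\<^sup>+y. g y * (ennreal (\<beta> * 2^k) * q k y) \<partial>lebesgue)"
      by (subst nn_integral_cmult[symmetric]) (auto simp: mult_ac)
    finally show ?thesis .
  qed
  have F_sq: "F k \<in> sets (sq_measure u)" for k by (simp add: sq_measure_def)
  have "ennreal \<sigma> * emeasure (sq_measure u) (\<Union>k<K. F k) \<le> ennreal \<sigma> * (\<Sum>k<K. emeasure (sq_measure u) (F k))"
    using F_sq by (intro mult_left_mono emeasure_subadditive_finite) auto
  also have "\<dots> = (\<Sum>k<K. ennreal \<sigma> * emeasure (sq_measure u) (F k))" by (rule sum_distrib_left)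
  also have "\<dots> \<le> (\<Sum>k<K. ennreal (4 * 20 ^ CARD('n)) * (\<integral>\<^sup>+y. g y * (ennreal (\<beta> * 2^k) * q k y) \<partial>lebesgue))"
    by (intro sum_mono level)
  also have "\<dots> = ennreal (4 * 20 ^ CARD('n)) * (\<integral>\<^sup>+y. g y * (\<Sum>k<K. ennreal (\<beta> * 2^k) * q k y) \<partial>lebesgue)"
    by (simp add: sum_distrib_left[symmetric] nn_integral_sum[symmetric])
  also have "\<dots> \<le> ennreal (4 * 20 ^ CARD('n)) * (\<integral>\<^sup>+y. ennreal (38 * 2^CARD('n) * A\<^sup>2) * (g y * ennreal (u y)) \<partial>lebesgue)"
  proof (intro mult_left_mono nn_integral_mono_AE)
    show "AE y in lebesgue. g y * (\<Sum>k<K. ennreal (\<beta> * 2^k) * q k y)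
        \<le> ennreal (38 * 2^CARD('n) * A\<^sup>2) * (g y * ennreal (u y))"
      using pos average_le
    proof eventually_elim
      case (elim y)
      have "(\<Sum>k<K. ennreal (\<beta> * 2^k) * q k y) \<le> ennreal (38 * 2^CARD('n) * A\<^sup>2 * u y)"
        using elim by (intro level_sum_le[OF \<open>0 < \<beta>\<close> _ _ sub q_avg]) auto
      also have "\<dots> = ennreal (38 * 2^CARD('n) * A\<^sup>2) * ennreal (u y)"
        using u_nonneg[of y] by (intro ennreal_mult) auto
      finally have "g y * (\<Sum>k<K. ennreal (\<beta> * 2^k) * q k y) \<le> g y * (ennreal (38 * 2^CARD('n) * A\<^sup>2) * ennreal (u y))"
        by (rule mult_left_mono) simp
      then show ?case by (simp only: mult_ac)
    qed
  qed simp
  also have "\<dots> = ennreal (4 * 20 ^ CARD('n)) * (ennreal (38 * 2^CARD('n) * A\<^sup>2) * (\<integral>\<^sup>+y. g y * ennreal (u y) \<partial>lebesgue))"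
    by (subst nn_integral_cmult) auto
  also have "\<dots> = ennreal (152 * 40 ^ CARD('n) * A\<^sup>2) * (\<integral>\<^sup>+y. g y * ennreal (u y) \<partial>lebesgue)"
  proof -
    have "(4 * 20 ^ CARD('n)) * (38 * 2^CARD('n) * A\<^sup>2) = 152 * 40 ^ CARD('n) * A\<^sup>2"
      by (simp add: power_mult_distrib[symmetric])
    then have "ennreal (4 * 20 ^ CARD('n)) * ennreal (38 * 2^CARD('n) * A\<^sup>2) = ennreal (152 * 40 ^ CARD('n) * A\<^sup>2)"
      by (subst ennreal_mult[symmetric]) auto
    then show ?thesis by (simp only: mult.assoc[symmetric])
  qed
  finally show ?thesis .
qed

text \<open>Increasing sets \<open>E N\<close>, on which both the radii and the values of
  \<open>u\<close> are bounded, cover almost all of the level set. Each falls under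
  \<open>weak_type_levels\<close> with \<open>2 * N\<close> levels and a constant free of
  \<open>N\<close>, so continuity from below gives the bound.\<close>

lemma weak_type:
  fixes f :: "real^'n \<Rightarrow> real"
  assumes pos: "AE x in lebesgue. 0 < u x" and f [measurable]: "f \<in> borel_measurable lebesgue" and "0 < t"
  shows "ennreal t * emeasure (sq_measure u)
      {x \<in> space (sq_measure u). ennreal t < HL_maximal (\<lambda>y. f y * u y) x / ennreal (u x)}
    \<le> ennreal (152 * (40 * real CARD('n)) ^ CARD('n) * A\<^sup>2) * L1_norm (sq_measure u) f"
proof -
  define g where "g y = ennreal \<bar>f y * u y\<bar>" for y
  have g [measurable]: "g \<in> borel_measurable lebesgue" unfolding g_def by measurable
  have L1: "(\<integral>\<^sup>+y. g y * ennreal (u y) \<partial>lebesgue) = L1_norm (sq_measure u) f"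
    unfolding L1_norm_def sq_measure_def
    using u_nonneg by (subst nn_integral_density)
      (auto intro!: nn_integral_cong simp: g_def ennreal_mult[symmetric] abs_mult power2_eq_square mult_ac)
  define d where "d = real CARD('n) ^ CARD('n)"
  have "0 < d" by (simp add: d_def)
  \<comment> \<open>Dividing by \<open>d\<close> makes up for the factor n^n in
    \<open>large_average_of_cube\<close>.\<close>
  define \<sigma> where "\<sigma> = t / d"
  have \<sigma>: "0 < \<sigma>" "t = d * \<sigma>" using \<open>0 < d\<close> \<open>0 < t\<close> by (auto simp: \<sigma>_def)
  \<comment> \<open>At stage \<open>N\<close> the levels \<open>k < 2 * N\<close> cover the values
    of \<open>u\<close> above \<open>(1/2)^N\<close> and up to \<open>2^N\<close>, with radii at
    most \<open>N\<close>.\<close>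
  define F where "F N k = {x \<in> large_average g (\<sigma> * ((1/2)^N * 2^k)) (real N).
      (1/2)^N * 2^k < u x \<and> u x \<le> (1/2)^N * 2^Suc k}" for N k :: nat
  define E where "E N = (\<Union>k<2 * N. F N k)" for N
  have F_meas [measurable]: "F N k \<in> sets lebesgue" for N k unfolding F_def by measurable
  have E_meas [measurable]: "E N \<in> sets lebesgue" for N unfolding E_def by measurable
  have "incseq E"
  proof (rule incseq_SucI)
    fix N
    \<comment> \<open>The lowest height is halved from one stage to the next, so the same dyadic
      height gets an index larger by one.\<close>
    have "F N k \<subseteq> F (Suc N) (Suc k)" for k
    proof -
      have "(1/2 :: real)^Suc N * 2^Suc j = (1/2)^N * 2^j" for j by simp
      then show ?thesis
        using large_average_mono[of "real N" "real (Suc N)" g "\<sigma> * ((1/2)^N * 2^k)"]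
        unfolding F_def by (simp only:) auto
    qed
    moreover have "Suc k < 2 * Suc N" if "k < 2 * N" for k using that by simp
    ultimately show "E N \<subseteq> E (Suc N)" unfolding E_def by blast
  qed
  have bound: "ennreal t * emeasure (sq_measure u) (E N)
      \<le> ennreal (152 * (40 * real CARD('n)) ^ CARD('n) * A\<^sup>2) * L1_norm (sq_measure u) f" for N
  proof -
    have "ennreal t * emeasure (sq_measure u) (E N) = ennreal d * (ennreal \<sigma> * emeasure (sq_measure u) (E N))"
      using \<sigma> \<open>0 < d\<close> by (simp add: ennreal_mult mult.assoc)
    also have "\<dots> \<le> ennreal d * (ennreal (152 * 40 ^ CARD('n) * A\<^sup>2) * L1_norm (sq_measure u) f)"
      unfolding E_def F_def L1[symmetric] using \<sigma>(1)
      by (intro mult_left_mono weak_type_levels pos g) auto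
    also have "\<dots> = ennreal (152 * (40 * real CARD('n)) ^ CARD('n) * A\<^sup>2) * L1_norm (sq_measure u) f"
      using \<open>0 < d\<close>
      by (simp add: mult.assoc[symmetric] ennreal_mult[symmetric]) (simp add: d_def power_mult_distrib mult_ac)
    finally show ?thesis .
  qed
  have covered: "\<exists>N. x \<in> E N" if "0 < u x" "ennreal t < HL_maximal (\<lambda>y. f y * u y) x / ennreal (u x)" for x
  proof -
    have "ennreal t * ennreal (u x) < HL_maximal (\<lambda>y. f y * u y) x"
    proof (rule ccontr)
      assume "\<not> ennreal t * ennreal (u x) < HL_maximal (\<lambda>y. f y * u y) x"
      then have "HL_maximal (\<lambda>y. f y * u y) x / ennreal (u x) \<le> ennreal t * ennreal (u x) / ennreal (u x)"
        by (intro divide_right_mono_ennreal) simp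
      also have "\<dots> = ennreal t" using \<open>0 < u x\<close> by (intro mult_divide_eq_ennreal) auto
      finally show False using that(2) by simp
    qed
    then obtain Q where Q: "Q \<in> cubes" "x \<in> Q" "ennreal t * ennreal (u x) < (\<integral>\<^sup>+y\<in>Q. g y \<partial>lebesgue) / emeasure lebesgue Q"
      unfolding HL_maximal_def less_SUP_iff g_def by blast
    then obtain a l where al: "0 < l" "Q = cbox a (\<chi> i. a $ i + l)" unfolding cubes_def by blast
    have eQ: "emeasure lebesgue Q = ennreal (l ^ CARD('n))"
      unfolding al(2) by (rule emeasure_cube_cbox(1)[OF al(1)])
    have avg: "ennreal (t * u x * l ^ CARD('n)) \<le> (\<integral>\<^sup>+y\<in>Q. g y \<partial>lebesgue)"
    proof (rule ccontr)
      assume "\<not> ?thesis"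
      then have "(\<integral>\<^sup>+y\<in>Q. g y \<partial>lebesgue) / ennreal (l ^ CARD('n)) \<le> ennreal (t * u x * l ^ CARD('n)) / ennreal (l ^ CARD('n))"
        by (intro divide_right_mono_ennreal) simp
      also have "\<dots> = ennreal t * ennreal (u x)"
        using al(1) \<open>0 < t\<close> \<open>0 < u x\<close> by (simp add: divide_ennreal ennreal_mult[symmetric])
      finally show False using Q(3) unfolding eQ by simp
    qed
    obtain N1 where N1: "(1/2)^N1 < u x" using real_arch_pow_inv[of "u x" "1/2"] \<open>0 < u x\<close> by auto
    obtain N2 where N2: "u x < 2^N2" using real_arch_pow[of 2 "u x"] by auto
    obtain N3 :: nat where N3: "real CARD('n) * l \<le> real N3" using real_arch_simple by blast
    \<comment> \<open>The maximum secures the lower bound, the upper bound and the radius at once;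
      the successor makes \<open>N\<close> positive, so that \<open>2 * N - 1\<close> is not
      truncated.\<close>
    define N where "N = Suc (max N1 (max N2 N3))"
    have lower: "(1/2)^N < u x"
    proof -
      have "(1/2 :: real)^N \<le> (1/2)^N1" by (intro power_decreasing) (auto simp: N_def)
      then show ?thesis using N1 by linarith
    qed
    have upper: "u x \<le> 2^N"
    proof -
      have "(2 :: real)^N2 \<le> 2^N" by (intro power_increasing) (auto simp: N_def)
      then show ?thesis using N2 by linarith
    qed
    \<comment> \<open>Minimality yields the lower bound on \<open>u x\<close> at level
      \<open>k\<close>, except for \<open>k = 0\<close>, where \<open>lower\<close> supplies
      it.\<close>
    define k where "k = (LEAST k. u x \<le> (1/2)^N * 2^Suc k)"
    have ex: "u x \<le> (1/2)^N * 2^Suc (2 * N - 1)"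
    proof -
      have "Suc (2 * N - 1) = N + N" by (simp add: N_def)
      then have "(1/2 :: real)^N * 2^Suc (2 * N - 1) = 2^N"
        by (simp add: power_add mult.assoc[symmetric] power_mult_distrib[symmetric])
      then show ?thesis using upper by simp
    qed
    have k_upper: "u x \<le> (1/2)^N * 2^Suc k" unfolding k_def using ex by (rule LeastI)
    have "k \<le> 2 * N - 1" unfolding k_def using ex by (rule Least_le)
    then have "k < 2 * N" by (simp add: N_def)
    have k_lower: "(1/2)^N * 2^k < u x"
    proof (cases k)
      case (Suc j)
      then show ?thesis using not_less_Least[of j "\<lambda>k. u x \<le> (1/2)^N * 2^Suc k"] by (simp add: k_def)
    qed (use lower in simp)
    have "x \<in> large_average g (\<sigma> * ((1/2)^N * 2^k)) (real N)"
    proof (rule large_average_of_cube[OF al(1)])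
      show "x \<in> cbox a (\<chi> i. a $ i + l)" using Q(2) al(2) by simp
      show "real CARD('n) * l \<le> real N" using N3 by (simp add: N_def)
      have "d * (\<sigma> * ((1/2)^N * 2^k)) * l ^ CARD('n) = t * ((1/2)^N * 2^k) * l ^ CARD('n)"
        by (simp add: \<sigma>(2))
      also have "\<dots> \<le> t * u x * l ^ CARD('n)"
        using k_lower \<open>0 < t\<close> al(1) by (intro mult_right_mono mult_left_mono) auto
      finally show "ennreal (real CARD('n) ^ CARD('n) * (\<sigma> * ((1/2)^N * 2^k)) * l ^ CARD('n))
          \<le> (\<integral>\<^sup>+y\<in>cbox a (\<chi> i. a $ i + l). g y \<partial>lebesgue)"
        using avg unfolding d_def al(2) by (meson ennreal_leI order_trans)
    qed (use \<sigma>(1) in simp)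
    then have "x \<in> F N k" using k_lower k_upper by (simp add: F_def)
    then show ?thesis using \<open>k < 2 * N\<close> unfolding E_def by blast
  qed
  \<comment> \<open>The sets \<open>E N\<close> are measurable by construction, so the level set of
    the maximal function enters only through an inclusion almost everywhere.\<close>
  have "AE x in sq_measure u. x \<in> {x \<in> space (sq_measure u). ennreal t < HL_maximal (\<lambda>y. f y * u y) x / ennreal (u x)}
      \<longrightarrow> x \<in> (\<Union>N. E N)"
    unfolding sq_measure_def
  proof (subst AE_density)
    show "AE x in lebesgue. 0 < ennreal ((u x)\<^sup>2) \<longrightarrow>
      x \<in> {x \<in> space (density lebesgue (\<lambda>x. ennreal ((u x)\<^sup>2))). ennreal t < HL_maximal (\<lambda>y. f y * u y) x / ennreal (u x)}
        \<longrightarrow> x \<in> (\<Union>N. E N)"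
      using pos by eventually_elim (use covered in auto)
  qed simp
  then have "emeasure (sq_measure u) {x \<in> space (sq_measure u). ennreal t < HL_maximal (\<lambda>y. f y * u y) x / ennreal (u x)}
      \<le> emeasure (sq_measure u) (\<Union>N. E N)"
    by (rule emeasure_mono_AE) (simp add: sq_measure_def)
  also have "\<dots> = (SUP N. emeasure (sq_measure u) (E N))"
    using \<open>incseq E\<close> by (intro SUP_emeasure_incseq[symmetric]) (auto simp: sq_measure_def)
  finally have "ennreal t * emeasure (sq_measure u) {x \<in> space (sq_measure u). ennreal t < HL_maximal (\<lambda>y. f y * u y) x / ennreal (u x)}
      \<le> (SUP N. ennreal t * emeasure (sq_measure u) (E N))"
    unfolding SUP_mult_left_ennreal[symmetric] by (rule mult_left_mono) simp
  also have "\<dots> \<le> ennreal (152 * (40 * real CARD('n)) ^ CARD('n) * A\<^sup>2) * L1_norm (sq_measure u) f"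
    by (rule SUP_least) (rule bound)
  finally show ?thesis .
qed

end

section \<open>Weights of class A1\<close>

text \<open>Off a single null set the essential supremum bounds
  \<open>HL_maximal u x / ennreal (u x)\<close>, and the maximal function then controls all cubes
  through \<open>x\<close> simultaneously.\<close>

lemma A1_weight_imp_bound:
  fixes u :: "real^'n \<Rightarrow> real"
  assumes "A1_weight u"
  shows "A1_bound u (enn2real (A1_const u))"
proof -
  define A where "A = enn2real (A1_const u)"
  have A: "A1_const u = ennreal A" "0 \<le> A"
    using assms by (auto simp: A_def A1_weight_def)
  have nonneg: "0 \<le> u x" for x using assms by (simp add: A1_weight_def weight_def)
  have int: "u absolutely_integrable_on cbox a b" for a b
    using assms by (simp add: A1_weight_def weight_def)
  have pos: "AE x in lebesgue. 0 < u x" using assms by (simp add: A1_weight_def weight_def)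
  \<comment> \<open>Local integrability makes the cut-offs to growing cubes measurable, and
    \<open>u\<close> is their pointwise limit.\<close>
  have meas [measurable]: "u \<in> borel_measurable lebesgue"
  proof -
    have cut: "(\<lambda>x. indicator (cbox (\<chi> i. - real k) (\<chi> i. real k)) x *\<^sub>R u x) \<in> borel_measurable lebesgue" for k :: nat
      using int[of "\<chi> i. - real k" "\<chi> i. real k"] unfolding set_integrable_def by (rule borel_measurable_integrable)
    have lim: "(\<lambda>k. indicator (cbox (\<chi> i. - real k) (\<chi> i. real k)) x *\<^sub>R u x) \<longlonglongrightarrow> u x" for x
    proof (rule tendsto_eventually)
      obtain k0 :: nat where k0: "norm x \<le> real k0" using real_arch_simple by blast
      have "x \<in> cbox (\<chi> i. - real k) (\<chi> i. real k)" if "k0 \<le> k" for k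
      proof -
        have "\<bar>x $ i\<bar> \<le> real k" for i
          using component_le_norm_cart[of x i] k0 that by linarith
        then show ?thesis unfolding mem_box_cart by (simp add: abs_le_iff) (metis minus_le_iff)
      qed
      then show "eventually (\<lambda>k. indicator (cbox (\<chi> i. - real k) (\<chi> i. real k)) x *\<^sub>R u x = u x) sequentially"
        unfolding eventually_sequentially by (intro exI[of _ k0]) simp
    qed
    show ?thesis by (rule borel_measurable_LIMSEQ_real[OF lim cut])
  qed
  let ?\<nu> = "density lebesgue (\<lambda>x. ennreal (u x))"
  have \<nu>_cbox: "emeasure ?\<nu> (cbox a b) = (\<integral>\<^sup>+y\<in>cbox a b. ennreal \<bar>u y\<bar> \<partial>lebesgue)" for a b
    using nonneg by (subst emeasure_density) auto
  have \<nu>_hcube: "emeasure ?\<nu> (hcube a l) \<le> emeasure ?\<nu> (cbox a (\<chi> i. a $ i + l))" for a l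
    by (rule emeasure_mono[OF hcube_subset_cbox]) simp
  have fin: "emeasure ?\<nu> (hcube a l) < \<infinity>" for a l
  proof -
    have "(\<integral>\<^sup>+y. ennreal (norm (indicator (cbox a (\<chi> i. a $ i + l)) y *\<^sub>R u y)) \<partial>lebesgue) < \<infinity>"
      using int[of a "\<chi> i. a $ i + l"] unfolding set_integrable_def integrable_iff_bounded by blast
    also have "(\<integral>\<^sup>+y. ennreal (norm (indicator (cbox a (\<chi> i. a $ i + l)) y *\<^sub>R u y)) \<partial>lebesgue)
        = emeasure ?\<nu> (cbox a (\<chi> i. a $ i + l))"
      unfolding \<nu>_cbox by (intro nn_integral_cong) (auto split: split_indicator)
    finally show ?thesis using \<nu>_hcube[of a l] by (rule le_less_trans[rotated])
  qed
  have avg: "AE x in lebesgue. \<forall>a l. 0 < l \<longrightarrow> x \<in> hcube a l \<longrightarrow>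
      emeasure ?\<nu> (hcube a l) \<le> ennreal (A * u x * l ^ CARD('n))"
    using pos esssup_AE[of "\<lambda>x. HL_maximal u x / ennreal (u x)" lebesgue]
  proof eventually_elim
    case (elim x)
    have le: "HL_maximal u x / ennreal (u x) \<le> ennreal A"
      using elim(2) A(1) by (simp add: A1_const_def)
    show ?case
    proof (intro allI impI)
      fix a :: "real^'n" and l :: real assume al: "0 < l" "x \<in> hcube a l"
      let ?Q = "cbox a (\<chi> i. a $ i + l)"
      have "?Q \<in> {Q \<in> cubes. x \<in> Q}" using al hcube_subset_cbox unfolding cubes_def by blast
      then have "(\<integral>\<^sup>+y\<in>?Q. ennreal \<bar>u y\<bar> \<partial>lebesgue) / emeasure lebesgue ?Q \<le> HL_maximal u x"
        unfolding HL_maximal_def by (rule SUP_upper)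
      then have "emeasure ?\<nu> ?Q / ennreal (l ^ CARD('n)) / ennreal (u x) \<le> ennreal A"
        unfolding \<nu>_cbox emeasure_cube_cbox(1)[OF al(1)] using le
        by (meson divide_right_mono_ennreal order_trans)
      then have "emeasure ?\<nu> ?Q / ennreal (l ^ CARD('n)) / ennreal (u x) * ennreal (u x) * ennreal (l ^ CARD('n))
          \<le> ennreal A * ennreal (u x) * ennreal (l ^ CARD('n))"
        by (intro mult_right_mono) auto
      also have "emeasure ?\<nu> ?Q / ennreal (l ^ CARD('n)) / ennreal (u x) * ennreal (u x) * ennreal (l ^ CARD('n)) = emeasure ?\<nu> ?Q"
        using elim(1) al(1) by (simp add: ennreal_divide_times ennreal_times_divide[symmetric] divide_eq_1_ennreal)
      also have "ennreal A * ennreal (u x) * ennreal (l ^ CARD('n)) = ennreal (A * u x * l ^ CARD('n))"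
        using A(2) elim(1) al(1) by (simp add: ennreal_mult)
      finally show "emeasure ?\<nu> (hcube a l) \<le> ennreal (A * u x * l ^ CARD('n))"
        using \<nu>_hcube[of a l] by (rule order_trans[rotated])
    qed
  qed
  \<comment> \<open>Integrating the A1 condition for the unit cube over that cube gives
    \<open>m \<le> A * m\<close>, where the mass \<open>m\<close> is finite, and positive because
    \<open>u\<close> is positive almost everywhere.\<close>
  have "1 \<le> A"
  proof -
    let ?Q = "hcube (0 :: real^'n) 1"
    obtain m where m: "emeasure ?\<nu> ?Q = ennreal m" "0 \<le> m"
      using fin[of 0 1] by (cases "emeasure ?\<nu> ?Q") auto
    have "m \<noteq> 0"
    proof
      assume "m = 0"
      then have "emeasure ?\<nu> ?Q = 0" using m by simp
      then have "AE x in lebesgue. ennreal (u x) * indicator ?Q x = 0"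
        by (subst (asm) emeasure_density) (auto simp: nn_integral_0_iff_AE)
      with pos have "AE x in lebesgue. x \<notin> ?Q"
        by eventually_elim (auto split: split_indicator_asm)
      then have "emeasure lebesgue ?Q = 0" by (subst (asm) AE_iff_measurable[of ?Q]) auto
      then show False by (simp add: emeasure_hcube del: emeasure_completion)
    qed
    have "ennreal m * emeasure lebesgue ?Q = (\<integral>\<^sup>+x. ennreal m * indicator ?Q x \<partial>lebesgue)"
      by (simp add: nn_integral_cmult_indicator)
    also have "\<dots> \<le> (\<integral>\<^sup>+x. ennreal A * (ennreal (u x) * indicator ?Q x) \<partial>lebesgue)"
    proof (rule nn_integral_mono_AE)
      show "AE x in lebesgue. ennreal m * indicator ?Q x \<le> ennreal A * (ennreal (u x) * indicator ?Q x)"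
        using avg
      proof eventually_elim
        case (elim x)
        then have "x \<in> ?Q \<Longrightarrow> ennreal m \<le> ennreal (A * u x)"
          unfolding m(1)[symmetric] by (metis mult.right_neutral power_one zero_less_one)
        then show ?case using A(2) nonneg[of x] by (simp add: ennreal_mult split: split_indicator)
      qed
    qed
    also have "\<dots> = ennreal A * ennreal m"
      unfolding m(1)[symmetric] by (subst nn_integral_cmult) (auto simp: emeasure_density)
    finally have "ennreal m \<le> ennreal (A * m)"
      using A(2) m(2) by (simp add: emeasure_hcube ennreal_mult del: emeasure_completion)
    then have "m \<le> A * m" using A(2) m(2) by simp
    then show ?thesis using m(2) \<open>m \<noteq> 0\<close> by simp
  qed
  then show ?thesis
    unfolding A_def[symmetric] using nonneg meas fin avg by unfold_locales auto
qed

theorem theorem4p5: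
  "\<exists>c::real. 0 < c \<and>
     (\<forall>(u :: real^'n \<Rightarrow> real) (f :: real^'n \<Rightarrow> real).
        A1_weight u \<longrightarrow> integrable (sq_measure u) f \<longrightarrow>
        weak_L1_norm (sq_measure u) (\<lambda>x. HL_maximal (\<lambda>y. f y * u y) x / ennreal (u x))
          \<le> ennreal c * (A1_const u)\<^sup>2 * L1_norm (sq_measure u) f)"
proof (intro exI conjI allI impI)
  \<comment> \<open>152 is 4 from squaring a dyadic level times 38 from \<open>level_sum_le\<close>;
    40 is 20 from the Vitali step times 2 from the Calderon-Zygmund parent, the latter entering
    through \<open>\<rho>\<close>; n^n comes from replacing cubes by balls.\<close>
  let ?c = "152 * (40 * real CARD('n)) ^ CARD('n)"
  show "0 < ?c" by simp
  fix u f :: "real^'n \<Rightarrow> real"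
  assume u: "A1_weight u" and f: "integrable (sq_measure u) f"
  define A where "A = enn2real (A1_const u)"
  interpret A1_bound u A unfolding A_def by (rule A1_weight_imp_bound[OF u])
  have A: "A1_const u = ennreal A" using u by (simp add: A_def A1_weight_def)
  have pos: "AE x in lebesgue. 0 < u x" using u by (simp add: A1_weight_def weight_def)
  have "f \<in> borel_measurable lebesgue"
    using borel_measurable_integrable[OF f] by (simp add: sq_measure_def)
  then have "weak_L1_norm (sq_measure u) (\<lambda>x. HL_maximal (\<lambda>y. f y * u y) x / ennreal (u x))
      \<le> ennreal (?c * A\<^sup>2) * L1_norm (sq_measure u) f"
    unfolding weak_L1_norm_def using weak_type[OF pos] by (intro SUP_least) auto
  also have "ennreal (?c * A\<^sup>2) = ennreal ?c * (A1_const u)\<^sup>2"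
    using A_ge_1 unfolding A by (simp add: ennreal_mult ennreal_power)
  finally show "weak_L1_norm (sq_measure u) (\<lambda>x. HL_maximal (\<lambda>y. f y * u y) x / ennreal (u x))
      \<le> ennreal ?c * (A1_const u)\<^sup>2 * L1_norm (sq_measure u) f" .
qed

end
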